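(* Let $K=(K_{j\rho l\sigma})_{1\le j,l\le d;\ \rho,\sigma\in\mathcal{R}}$ be a real tensor. Assume that $K_{j\rho l\sigma}=K_{l\sigma j\rho}$ for all $j,l,\rho,\sigma$ and that additionally $K_{j\rho l\sigma}=K_{j(-\rho)l(-\sigma)}$ for all $j,l,\rho,\sigma$ or $K_{j\rho l\sigma}=K_{l\rho j\sigma}$ for all $j,l,\rho,\sigma$. Then $$\lambda_{\rm atom}(K)=\inf\bigg\{\frac{K[\xi\otimes c(k),\xi\otimes c(k)]+K[\xi\otimes s(k),\xi\otimes s(k)]}{|\xi|^2\big(|c(k)|^2+|s(k)|^2\big)}\colon\xi\in\mathbb{R}^d\setminus\{0\},\ k\in[0,2\pi)^d\setminus\{0\}\bigg\},$$ where $c(k)_\rho=\cos(\rho k)-1$ and $s(k)_\rho=\sin(\rho k)$ for $\rho\in\mathcal{R}$.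
   Context: $\mathcal{R}\subset\mathbb{Z}^d\setminus\{0\}$ is a finite set with $\operatorname{span}_{\mathbb{Z}}\mathcal{R}=\mathbb{Z}^d$ and $\mathcal{R}=-\mathcal{R}$. $\rho k$ denotes the Euclidean scalar product. $K[A,B]=\sum_{j,l,\rho,\sigma}K_{j\rho l\sigma}A_{j\rho}B_{l\sigma}$ for $A,B\in\mathbb{R}^{d\times\mathcal{R}}$; for $\xi\in\mathbb{R}^d$, $b\in\mathbb{R}^{\mathcal{R}}$, $(\xi\otimes b)_{j\rho}=\xi_jb_\rho$. Atomistic stability constant: $D_{\mathcal{R},\varepsilon}y(x)=\big(\frac{y(x+\varepsilon\rho)-y(x)}{\varepsilon}\big)_{\rho\in\mathcal{R}}$; $R_0=\max\{\max_{\rho\in\mathcal{R}}|\rho|,\sqrt d/4\}$; for an open, bounded, nonempty $\Omega\subset\mathbb{R}^d$, $\operatorname{sint}_\varepsilon\Omega=\{x\in\Omega\cap\varepsilon\mathbb{Z}^d:\operatorname{dist}(x,\partial\Omega)>\varepsilon R_0\}$ and $\mathcal{A}_\varepsilon(\Omega,0)$ is the set of $y\colon\Omega\cap\varepsilon\mathbb{Z}^d\to\mathbb{R}^d$ with $y(x)=0$ whenever $\operatorname{dist}(x,\partial\Omega)\le2\varepsilon R_0$; then $$\lambda_{\rm atom}(K)=\inf_{\varepsilon>0}\ \inf_{y\in\mathcal{A}_\varepsilon(\Omega,0),\,y\ne0}\frac{\sum_{x\in\operatorname{sint}_\varepsilon\Omega}K[D_{\mathcal{R},\varepsilon}y(x),D_{\mathcal{R},\varepsilon}y(x)]}{\sum_{x\in\operatorname{sint}_\varepsilon\Omega}|D_{\mathcal{R},\varepsilon}y(x)|^2},$$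 which does not depend on the choice of $\Omega$. *)

theory Defs
  imports "HOL-Analysis.Analysis"
begin

definition int_lattice :: "(real ^ 'n) set" where
  "int_lattice = {x. \<forall>i. x $ i \<in> \<int>}"

definition scaled_lattice :: "real \<Rightarrow> (real ^ 'n) set" where
  "scaled_lattice \<epsilon> = (\<lambda>z. \<epsilon> *\<^sub>R z) ` int_lattice"

text \<open>The integer span is the library's span for the \<open>\<int>\<close>-module structure of the space;
  the following lemma licenses the use of the facts of the locale \<^locale>\<open>module\<close>.\<close>

lemma module_int_scale: "module (\<lambda>(n::int) (v::'a::real_vector). of_int n *\<^sub>R v)"
  by unfold_locales (simp_all add: algebra_simps)

definition int_span :: "'a::real_vector set \<Rightarrow> 'a set" where
  "int_span = module.span (\<lambda>(n::int) v. of_int n *\<^sub>R v)"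

text \<open>An interaction range is a set \<open>R\<close> of vectors with integer entries. Elements of
  \<open>\<real>\<^sup>R\<close>, of \<open>\<real>\<^bsup>d \<times> R\<^esup>\<close> and tensors \<open>K\<close> are functions whose \<open>R\<close>-arguments range over all
  of \<^typ>\<open>real ^ 'n\<close>; only their values on \<open>R\<close> are ever used.\<close>

type_synonym 'n range_mat = "'n \<Rightarrow> real ^ 'n \<Rightarrow> real"
type_synonym 'n range_tensor = "'n \<Rightarrow> real ^ 'n \<Rightarrow> 'n \<Rightarrow> real ^ 'n \<Rightarrow> real"

definition tensor_form ::
  "(real ^ 'n) set \<Rightarrow> 'n::finite range_tensor \<Rightarrow> 'n range_mat \<Rightarrow> 'n range_mat \<Rightarrow> real" where
  "tensor_form R K A B =
     (\<Sum>j\<in>UNIV. \<Sum>\<rho>\<in>R. \<Sum>l\<in>UNIV. \<Sum>\<sigma>\<in>R. K j \<rho> l \<sigma> * A j \<rho> * B l \<sigma>)"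

definition vec_norm_sq :: "(real ^ 'n) set \<Rightarrow> (real ^ 'n \<Rightarrow> real) \<Rightarrow> real" where
  "vec_norm_sq R b = (\<Sum>\<rho>\<in>R. (b \<rho>)\<^sup>2)"

definition mat_norm_sq :: "(real ^ 'n) set \<Rightarrow> 'n::finite range_mat \<Rightarrow> real" where
  "mat_norm_sq R A = (\<Sum>j\<in>UNIV. \<Sum>\<rho>\<in>R. (A j \<rho>)\<^sup>2)"

definition outer :: "real ^ 'n \<Rightarrow> (real ^ 'n \<Rightarrow> real) \<Rightarrow> 'n::finite range_mat" where
  "outer \<xi> b = (\<lambda>j \<rho>. \<xi> $ j * b \<rho>)"

definition discrete_grad ::
  "real \<Rightarrow> (real ^ 'n \<Rightarrow> real ^ 'n) \<Rightarrow> real ^ 'n \<Rightarrow> 'n::finite range_mat" where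
  "discrete_grad \<epsilon> y x = (\<lambda>j \<rho>. ((y (x + \<epsilon> *\<^sub>R \<rho>) - y x) /\<^sub>R \<epsilon>) $ j)"

definition R0 :: "(real ^ 'n::finite) set \<Rightarrow> real" where
  "R0 R = max (Max (norm ` R)) (sqrt (real CARD('n)) / 4)"

definition sint :: "(real ^ 'n::finite) set \<Rightarrow> real \<Rightarrow> (real ^ 'n) set \<Rightarrow> (real ^ 'n) set" where
  "sint R \<epsilon> \<Omega> = {x \<in> \<Omega> \<inter> scaled_lattice \<epsilon>. infdist x (frontier \<Omega>) > \<epsilon> * R0 R}"

text \<open>Functions defined exactly on the lattice points of \<open>\<Omega>\<close>. For \<open>x \<in> sint R \<epsilon> \<Omega>\<close> the points
  \<open>x + \<epsilon> *\<^sub>R \<rho>\<close> with \<open>\<rho> \<in> R\<close> lie in \<open>\<Omega>\<close>, so the arbitrary value of such a function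
  outside its domain never enters the stability quotient.\<close>

definition admissible ::
  "(real ^ 'n::finite) set \<Rightarrow> real \<Rightarrow> (real ^ 'n) set \<Rightarrow> (real ^ 'n \<Rightarrow> real ^ 'n) set" where
  "admissible R \<epsilon> \<Omega> =
     {y \<in> (\<Omega> \<inter> scaled_lattice \<epsilon>) \<rightarrow>\<^sub>E UNIV.
        \<forall>x \<in> \<Omega> \<inter> scaled_lattice \<epsilon>. infdist x (frontier \<Omega>) \<le> 2 * \<epsilon> * R0 R \<longrightarrow> y x = 0}"

text \<open>The infima are taken in the extended reals: for large \<open>\<epsilon>\<close> there is no nonzero admissible
  function and the inner infimum is \<open>\<infinity>\<close>.\<close>

definition lambda_atom ::
  "(real ^ 'n::finite) set \<Rightarrow> (real ^ 'n) set \<Rightarrow> 'n range_tensor \<Rightarrow> ereal" where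
  "lambda_atom R \<Omega> K =
     (INF \<epsilon> \<in> {0<..}. INF y \<in> {y \<in> admissible R \<epsilon> \<Omega>. \<exists>x \<in> \<Omega> \<inter> scaled_lattice \<epsilon>. y x \<noteq> 0}.
        ereal ((\<Sum>x\<in>sint R \<epsilon> \<Omega>. tensor_form R K (discrete_grad \<epsilon> y x) (discrete_grad \<epsilon> y x)) /
               (\<Sum>x\<in>sint R \<epsilon> \<Omega>. mat_norm_sq R (discrete_grad \<epsilon> y x))))"

definition cos_vec :: "real ^ 'n \<Rightarrow> real ^ 'n::finite \<Rightarrow> real" where
  "cos_vec k \<rho> = cos (\<rho> \<bullet> k) - 1"

definition sin_vec :: "real ^ 'n \<Rightarrow> real ^ 'n::finite \<Rightarrow> real" where
  "sin_vec k \<rho> = sin (\<rho> \<bullet> k)"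

end

theory Submission
  imports Defs
begin

text \<open>
  Subtracting \<open>L\<close> times the identity from \<open>K\<close> turns ``\<open>L\<close> is at most the infimum'' into nonnegativity,
  on both sides: the claim becomes that \<open>\<Sum>\<^sub>z K[Du(z), Du(z)] \<ge> 0\<close> for all finitely supported
  \<open>u\<close> on the integer lattice if and only if the symbol \<open>K[\<xi> \<otimes> c(k), \<xi> \<otimes> c(k)] + K[\<xi> \<otimes> s(k), \<xi> \<otimes> s(k)]\<close> is
  nonnegative. If the symbol is nonnegative, embed the support of \<open>u\<close> into a large discrete torus and
  apply Parseval's identity there, so that only finitely many frequencies occur; the additional
  symmetry of \<open>K\<close> makes the mixed terms of the real and imaginary parts of the Fourier
  coefficients cancel. Conversely, cut off \<open>\<xi> cos(k z)\<close> and \<open>\<xi> sin(k z)\<close> to a box of side \<open>n\<close>: the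
  energies of the two functions add up to exactly the symbol at each interior point, and the boundary
  layer contributes only \<open>O(n\<^bsup>d-1\<^esup>)\<close>.
\<close>

subsection \<open>Quadratic forms on the interaction range\<close>

definition shift_tensor :: "'n range_tensor \<Rightarrow> real \<Rightarrow> 'n range_tensor" where
  "shift_tensor K L = (\<lambda>j \<rho> l \<sigma>. K j \<rho> l \<sigma> - (if j = l \<and> \<rho> = \<sigma> then L else 0))"

text \<open>Off \<open>S\<close> both \<open>u\<close> and its discrete gradient vanish at lattice points, so that sums over \<open>S\<close>
  stand for sums over the whole lattice.\<close>

definition support_within ::
    "(real ^ 'n) set \<Rightarrow> (real ^ 'n \<Rightarrow> real ^ 'n) \<Rightarrow> (real ^ 'n) set \<Rightarrow> bool" where
  "support_within R u S \<longleftrightarrow> finite S \<and> S \<subseteq> int_lattice \<and>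
     (\<forall>z \<in> int_lattice - S. \<forall>\<rho> \<in> insert 0 R. u (z + \<rho>) = 0)"

text \<open>Neither \<open>\<epsilon>\<close> nor \<open>\<Omega>\<close> occurs here, so
  characterising lower bounds of \<open>lambda_atom\<close> by this condition makes them independent
  of the domain. The set \<open>S\<close> is only a window of summation: the sum is the same for
  every window within which \<open>u\<close> is supported.\<close>

definition lattice_stable :: "(real ^ 'n) set \<Rightarrow> 'n::finite range_tensor \<Rightarrow> bool" where
  "lattice_stable R K \<longleftrightarrow> (\<forall>u S. support_within R u S \<longrightarrow>
     0 \<le> (\<Sum>z\<in>S. tensor_form R K (discrete_grad 1 u z) (discrete_grad 1 u z)))"

text \<open>This is the real part of the Hermitian extension of \<open>K\<close> at the tensor
  product of \<open>\<xi>\<close> with \<open>cos_vec k\<close> + i \<open>sin_vec k\<close>, the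
  amplitude of the gradient of the plane wave \<open>\<xi>\<close> exp(i k z).\<close>

definition symbol_form ::
    "(real ^ 'n) set \<Rightarrow> 'n::finite range_tensor \<Rightarrow> real ^ 'n \<Rightarrow> real ^ 'n \<Rightarrow> real" where
  "symbol_form R K \<xi> k =
     tensor_form R K (outer \<xi> (cos_vec k)) (outer \<xi> (cos_vec k)) +
     tensor_form R K (outer \<xi> (sin_vec k)) (outer \<xi> (sin_vec k))"

lemma tensor_form_cong:
  assumes "\<And>j \<rho>. \<rho> \<in> R \<Longrightarrow> A j \<rho> = A' j \<rho>" "\<And>j \<rho>. \<rho> \<in> R \<Longrightarrow> B j \<rho> = B' j \<rho>"
  shows "tensor_form R K A B = tensor_form R K A' B'"
  unfolding tensor_form_def using assms by (intro sum.cong refl) auto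

lemma tensor_form_add_left:
  "tensor_form R K (\<lambda>j \<rho>. A j \<rho> + A' j \<rho>) B = tensor_form R K A B + tensor_form R K A' B"
  by (simp add: tensor_form_def algebra_simps sum.distrib)

lemma tensor_form_add_right:
  "tensor_form R K A (\<lambda>j \<rho>. B j \<rho> + B' j \<rho>) = tensor_form R K A B + tensor_form R K A B'"
  by (simp add: tensor_form_def algebra_simps sum.distrib)

lemma tensor_form_scale_left:
  "tensor_form R K (\<lambda>j \<rho>. a * A j \<rho>) B = a * tensor_form R K A B"
  by (simp add: tensor_form_def sum_distrib_left mult_ac)

lemma tensor_form_scale_right:
  "tensor_form R K A (\<lambda>j \<rho>. a * B j \<rho>) = a * tensor_form R K A B"
  by (simp add: tensor_form_def sum_distrib_left mult_ac)

lemma tensor_form_diff_left: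
  "tensor_form R K (\<lambda>j \<rho>. A j \<rho> - A' j \<rho>) B = tensor_form R K A B - tensor_form R K A' B"
  by (simp add: tensor_form_def algebra_simps sum_subtractf)

lemma tensor_form_diff_right:
  "tensor_form R K A (\<lambda>j \<rho>. B j \<rho> - B' j \<rho>) = tensor_form R K A B - tensor_form R K A B'"
  by (simp add: tensor_form_def algebra_simps sum_subtractf)

lemmas tensor_form_bilinear =
  tensor_form_add_left tensor_form_add_right tensor_form_diff_left tensor_form_diff_right
  tensor_form_scale_left tensor_form_scale_right

lemma mat_norm_sq_nonneg: "0 \<le> mat_norm_sq R A"
  by (simp add: mat_norm_sq_def sum_nonneg)

lemma mat_norm_sq_outer: "mat_norm_sq R (outer \<xi> b) = (norm \<xi>)\<^sup>2 * vec_norm_sq R b"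
  by (simp add: mat_norm_sq_def vec_norm_sq_def outer_def power_mult_distrib norm_vec_def
      L2_set_def sum_nonneg sum_distrib_left sum_distrib_right)
    (rule sum.swap)

lemma tensor_form_shift:
  assumes "finite R"
  shows "tensor_form R (shift_tensor K L) A A = tensor_form R K A A - L * mat_norm_sq R A"
proof -
  have "(\<Sum>j\<in>UNIV. \<Sum>\<rho>\<in>R. \<Sum>l\<in>UNIV. \<Sum>\<sigma>\<in>R. (if j = l \<and> \<rho> = \<sigma> then L else 0) * A j \<rho> * A l \<sigma>)
      = (\<Sum>j\<in>UNIV. \<Sum>\<rho>\<in>R. L * (A j \<rho>)\<^sup>2)"
  proof (intro sum.cong refl)
    fix j \<rho> assume "\<rho> \<in> R"
    have "(\<Sum>l\<in>UNIV. \<Sum>\<sigma>\<in>R. (if j = l \<and> \<rho> = \<sigma> then L else 0) * A j \<rho> * A l \<sigma>)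
        = (\<Sum>l\<in>UNIV. if j = l then (\<Sum>\<sigma>\<in>R. if \<rho> = \<sigma> then L * A j \<rho> * A j \<rho> else 0) else 0)"
      by (intro sum.cong refl) (auto intro!: sum.cong)
    also have "\<dots> = L * (A j \<rho>)\<^sup>2"
      using \<open>\<rho> \<in> R\<close> assms by (simp add: power2_eq_square)
    finally show "(\<Sum>l\<in>UNIV. \<Sum>\<sigma>\<in>R. (if j = l \<and> \<rho> = \<sigma> then L else 0) * A j \<rho> * A l \<sigma>)
        = L * (A j \<rho>)\<^sup>2" .
  qed
  then show ?thesis
    by (simp add: tensor_form_def shift_tensor_def mat_norm_sq_def left_diff_distrib
        sum_subtractf sum_distrib_left)
qed

lemma symbol_form_shift:
  assumes "finite R"
  shows "symbol_form R (shift_tensor K L) \<xi> k =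
    symbol_form R K \<xi> k
      - L * ((norm \<xi>)\<^sup>2 * (vec_norm_sq R (cos_vec k) + vec_norm_sq R (sin_vec k)))"
  using assms by (simp add: symbol_form_def tensor_form_shift mat_norm_sq_outer algebra_simps)

text \<open>This is where the symmetry of \<open>K\<close> enters. If the form is invariant under
  reflection of \<open>R\<close>, both sides vanish, since \<open>cos_vec k\<close> is even and
  \<open>sin_vec k\<close> is odd. In the other case \<open>\<rho>\<close> and
  \<open>\<sigma>\<close> can be exchanged at fixed \<open>j\<close> and \<open>l\<close>, and
  relabelling the sums gives the identity.\<close>

lemma tensor_form_outer_cross:
  assumes R: "R = uminus ` R"
    and major: "\<And>j l \<rho> \<sigma>. \<rho> \<in> R \<Longrightarrow> \<sigma> \<in> R \<Longrightarrow> K j \<rho> l \<sigma> = K l \<sigma> j \<rho>"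
    and minor: "(\<forall>j l. \<forall>\<rho>\<in>R. \<forall>\<sigma>\<in>R. K j \<rho> l \<sigma> = K j (- \<rho>) l (- \<sigma>)) \<or>
         (\<forall>j l. \<forall>\<rho>\<in>R. \<forall>\<sigma>\<in>R. K j \<rho> l \<sigma> = K l \<rho> j \<sigma>)"
  shows "tensor_form R K (outer a (cos_vec k)) (outer b (sin_vec k)) =
         tensor_form R K (outer a (sin_vec k)) (outer b (cos_vec k))"
  using minor
proof
  assume inv: "\<forall>j l. \<forall>\<rho>\<in>R. \<forall>\<sigma>\<in>R. K j \<rho> l \<sigma> = K j (- \<rho>) l (- \<sigma>)"
  have negR: "sum g R = (\<Sum>\<rho>\<in>R. g (- \<rho>))" for g :: "real ^ 'a \<Rightarrow> real"
    by (subst R, subst sum.reindex) auto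
  have neg: "tensor_form R K A B = tensor_form R K (\<lambda>j \<rho>. A j (-\<rho>)) (\<lambda>j \<rho>. B j (-\<rho>))" for A B
  proof -
    have "tensor_form R K A B =
      (\<Sum>j\<in>UNIV. \<Sum>\<rho>\<in>R. \<Sum>l\<in>UNIV. \<Sum>\<sigma>\<in>R. K j (-\<rho>) l (-\<sigma>) * A j (-\<rho>) * B l (-\<sigma>))"
      unfolding tensor_form_def by (subst negR, subst (2) negR, rule refl)
    also have "\<dots> = tensor_form R K (\<lambda>j \<rho>. A j (-\<rho>)) (\<lambda>j \<rho>. B j (-\<rho>))"
      unfolding tensor_form_def using inv by (intro sum.cong refl) auto
    finally show ?thesis .
  qed
  have odd: "outer a (sin_vec k) j (-\<rho>) = (-1) * outer a (sin_vec k) j \<rho>"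
    and even: "outer a (cos_vec k) j (-\<rho>) = outer a (cos_vec k) j \<rho>" for a j \<rho>
    by (simp_all add: outer_def sin_vec_def cos_vec_def)
  \<comment> \<open>Reflecting both arguments changes the sign of the odd one only, so the value
    equals its own negative.\<close>
  have "tensor_form R K (outer a (cos_vec k)) (outer b (sin_vec k)) = 0"
    using neg[of "outer a (cos_vec k)" "outer b (sin_vec k)"]
    unfolding odd even tensor_form_scale_right by simp
  moreover have "tensor_form R K (outer a (sin_vec k)) (outer b (cos_vec k)) = 0"
    using neg[of "outer a (sin_vec k)" "outer b (cos_vec k)"]
    unfolding odd even tensor_form_scale_left by simp
  ultimately show ?thesis by simp
next
  assume tr: "\<forall>j l. \<forall>\<rho>\<in>R. \<forall>\<sigma>\<in>R. K j \<rho> l \<sigma> = K l \<rho> j \<sigma>"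
  \<comment> \<open>The full exchange of (\<open>j\<close>, \<open>\<rho>\<close>) with
    (\<open>l\<close>, \<open>\<sigma>\<close>), followed by the exchange of \<open>j\<close> and
    \<open>l\<close>, leaves an exchange of \<open>\<rho>\<close> and \<open>\<sigma>\<close>
    alone.\<close>
  have swap: "K j \<rho> l \<sigma> = K j \<sigma> l \<rho>" if "\<rho> \<in> R" "\<sigma> \<in> R" for j l \<rho> \<sigma>
    using tr major that by metis
  have "tensor_form R K (outer a (cos_vec k)) (outer b (sin_vec k)) =
     (\<Sum>j\<in>UNIV. \<Sum>l\<in>UNIV. \<Sum>\<rho>\<in>R. \<Sum>\<sigma>\<in>R. K j \<sigma> l \<rho> * (a$j * cos_vec k \<rho>) * (b$l * sin_vec k \<sigma>))"
    unfolding tensor_form_def outer_def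
    by (intro sum.cong refl, subst sum.swap, intro sum.cong refl, subst swap) auto
  also have "\<dots> =
     (\<Sum>j\<in>UNIV. \<Sum>l\<in>UNIV. \<Sum>\<sigma>\<in>R. \<Sum>\<rho>\<in>R. K j \<sigma> l \<rho> * (a$j * sin_vec k \<sigma>) * (b$l * cos_vec k \<rho>))"
    by (rule sum.cong[OF refl], rule sum.cong[OF refl], subst sum.swap) (simp add: mult_ac)
  also have "\<dots> = tensor_form R K (outer a (sin_vec k)) (outer b (cos_vec k))"
    unfolding tensor_form_def outer_def
    by (rule sum.cong[OF refl], rule sum.swap)
  finally show ?thesis .
qed

text \<open>\<open>A\<close> and \<open>B\<close> are the real and imaginary parts of (a + ib) times
  (\<open>cos_vec k\<close> - i \<open>sin_vec k\<close>). On expansion the mixed terms of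
  \<open>A\<close> cancel against those of \<open>B\<close>, so a complex amplitude costs no more
  than two real ones; this is why real \<open>\<xi>\<close> suffice in the infimum.\<close>

lemma tensor_form_outer_combination:
  assumes cross: "tensor_form R K (outer a (cos_vec k)) (outer b (sin_vec k)) =
         tensor_form R K (outer a (sin_vec k)) (outer b (cos_vec k))"
   and cross': "tensor_form R K (outer b (cos_vec k)) (outer a (sin_vec k)) =
         tensor_form R K (outer b (sin_vec k)) (outer a (cos_vec k))"
  defines "A \<equiv> \<lambda>j \<rho>. outer a (cos_vec k) j \<rho> + outer b (sin_vec k) j \<rho>"
    and "B \<equiv> \<lambda>j \<rho>. outer b (cos_vec k) j \<rho> - outer a (sin_vec k) j \<rho>"
  shows "tensor_form R K A A + tensor_form R K B B = symbol_form R K a k + symbol_form R K b k"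
  unfolding A_def B_def symbol_form_def tensor_form_bilinear
  using cross cross' by simp

subsection \<open>Parseval's identity on a discrete torus\<close>

lemma int_lattice_add: "x \<in> int_lattice \<Longrightarrow> y \<in> int_lattice \<Longrightarrow> x + y \<in> int_lattice"
  and int_lattice_diff: "x \<in> int_lattice \<Longrightarrow> y \<in> int_lattice \<Longrightarrow> x - y \<in> int_lattice"
  by (auto simp: int_lattice_def)

text \<open>For \<open>m i < N\<close> these are the frequencies of the characters of the torus of
  side \<open>N\<close>, represented in the half-open cube from 0 to 2 pi.\<close>

definition torus_freq :: "nat \<Rightarrow> ('n \<Rightarrow> nat) \<Rightarrow> real ^ 'n::finite" where
  "torus_freq N m = (\<chi> i. 2 * pi * real (m i) / real N)"

text \<open>The sum is geometric with ratio \<open>x\<close> = exp(2 pi i a / N) and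
  \<open>x ^ N = 1\<close>. For nonzero \<open>a\<close> the bound on \<open>a\<close> excludes
  multiples of \<open>N\<close>, hence \<open>x \<noteq> 1\<close> and the sum vanishes.\<close>

lemma roots_of_unity_sum:
  fixes a :: int
  assumes "0 < N" "\<bar>a\<bar> < int N"
  shows "(\<Sum>t<N. cis (real_of_int a * (2 * pi * real t / real N))) = (if a = 0 then of_nat N else 0)"
proof (cases "a = 0")
  case False
  define x where "x = cis (2 * pi * real_of_int a / real N)"
  have pow: "cis (real_of_int a * (2 * pi * real t / real N)) = x ^ t" for t
    unfolding x_def Complex.DeMoivre by (rule arg_cong[of _ _ cis]) simp
  have "x \<noteq> 1"
  proof
    assume "x = 1"
    then have "cos (2 * pi * real_of_int a / real N) = 1"
      unfolding x_def by (simp add: complex_eq_iff)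
    then obtain n :: int where "2 * pi * real_of_int a / real N = real_of_int n * 2 * pi"
      by (auto simp: cos_one_2pi_int)
    then have "real_of_int a = real_of_int (n * int N)"
      using \<open>0 < N\<close> by (simp add: field_simps)
    then have "a = n * int N" by linarith
    moreover from this False have "n \<noteq> 0" by auto
    ultimately have "int N \<le> \<bar>a\<bar>"
      using mult_right_mono[of 1 "\<bar>n\<bar>" "int N"] by (auto simp: abs_mult)
    then show False using assms by simp
  qed
  moreover have "x ^ N = 1"
    using \<open>0 < N\<close> by (simp add: x_def Complex.DeMoivre cis_multiple_2pi)
  ultimately show ?thesis using False unfolding pow by (simp add: geometric_sum)
qed simp

text \<open>The complex exponential factorises over the coordinates, so the sum over all
  \<open>m\<close> is a product of one-dimensional sums over roots of unity; a single nonzero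
  coordinate of \<open>v\<close> annihilates it. The claim is the real part.\<close>

lemma torus_cos_sum:
  fixes v :: "real ^ 'n::finite"
  assumes "0 < N" "v \<in> int_lattice" "\<And>i. \<bar>v $ i\<bar> < real N"
  shows "(\<Sum>m\<in>UNIV \<rightarrow>\<^sub>E {..<N}. cos (v \<bullet> torus_freq N m)) = (if v = 0 then real N ^ CARD('n) else 0)"
proof -
  obtain a where a: "\<And>i. v $ i = real_of_int (a i)"
    using assms(2) unfolding int_lattice_def Ints_def by (auto simp: image_iff) metis
  have small: "\<bar>a i\<bar> < int N" for i
    using assms(3)[of i] unfolding a by linarith
  have prod_cis: "cis (sum f A) = (\<Prod>i\<in>A. cis (f i))" for f and A :: "'n set"
    by (induction A rule: infinite_finite_induct) (auto simp: cis_mult[symmetric])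
  have "(\<Sum>m\<in>UNIV \<rightarrow>\<^sub>E {..<N}. cis (v \<bullet> torus_freq N m)) =
      (\<Sum>m\<in>UNIV \<rightarrow>\<^sub>E {..<N}. \<Prod>i\<in>UNIV. cis (real_of_int (a i) * (2 * pi * real (m i) / real N)))"
    by (simp add: inner_vec_def torus_freq_def a prod_cis)
  also have "\<dots> = (\<Prod>i\<in>UNIV. \<Sum>t<N. cis (real_of_int (a i) * (2 * pi * real t / real N)))"
    by (subst prod_sum_PiE) auto
  also have "\<dots> = (\<Prod>i\<in>UNIV. if a i = 0 then of_nat N else 0)"
    using roots_of_unity_sum[OF assms(1) small] by simp
  also have "\<dots> = (if v = 0 then of_nat N ^ CARD('n) else 0)"
    by (auto simp: vec_eq_iff a)
  finally have "Re (\<Sum>m\<in>UNIV \<rightarrow>\<^sub>E {..<N}. cis (v \<bullet> torus_freq N m)) =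
      Re (if v = 0 then of_nat N ^ CARD('n) else 0)" by simp
  also have "Re (if v = 0 then of_nat N ^ CARD('n) else 0) = (if v = 0 then real N ^ CARD('n) else 0)"
    by (simp flip: of_nat_power)
  finally show ?thesis by simp
qed

text \<open>The two products combine to cos((z - z') k) by the addition theorem, and summing over
  the frequencies leaves the diagonal z = z'. The bound \<open>small\<close> keeps distinct points
  of \<open>S\<close> distinct modulo \<open>N\<close>, so that nothing wraps around the
  torus.\<close>

lemma torus_parseval:
  fixes S :: "(real ^ 'n::finite) set" and f g :: "real ^ 'n \<Rightarrow> real"
  assumes "finite S" "S \<subseteq> int_lattice" "0 < N"
    and small: "\<And>z z' i. z \<in> S \<Longrightarrow> z' \<in> S \<Longrightarrow> \<bar>z $ i - z' $ i\<bar> < real N"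
  shows "(\<Sum>m\<in>UNIV \<rightarrow>\<^sub>E {..<N}.
      (\<Sum>z\<in>S. f z * cos (z \<bullet> torus_freq N m)) * (\<Sum>z\<in>S. g z * cos (z \<bullet> torus_freq N m)) +
      (\<Sum>z\<in>S. f z * sin (z \<bullet> torus_freq N m)) * (\<Sum>z\<in>S. g z * sin (z \<bullet> torus_freq N m)))
    = real N ^ CARD('n) * (\<Sum>z\<in>S. f z * g z)"
proof -
  have "(\<Sum>m\<in>UNIV \<rightarrow>\<^sub>E {..<N}.
      (\<Sum>z\<in>S. f z * cos (z \<bullet> torus_freq N m)) * (\<Sum>z\<in>S. g z * cos (z \<bullet> torus_freq N m)) +
      (\<Sum>z\<in>S. f z * sin (z \<bullet> torus_freq N m)) * (\<Sum>z\<in>S. g z * sin (z \<bullet> torus_freq N m)))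
    = (\<Sum>m\<in>UNIV \<rightarrow>\<^sub>E {..<N}. \<Sum>z\<in>S. \<Sum>z'\<in>S. f z * g z' * cos ((z - z') \<bullet> torus_freq N m))"
    by (simp add: sum_product inner_diff_left cos_diff algebra_simps sum.distrib)
  also have "\<dots> = (\<Sum>z\<in>S. \<Sum>z'\<in>S. f z * g z' * (\<Sum>m\<in>UNIV \<rightarrow>\<^sub>E {..<N}. cos ((z - z') \<bullet> torus_freq N m)))"
    by (subst sum.swap, intro sum.cong refl, subst sum.swap, simp add: sum_distrib_left)
  also have "\<dots> = (\<Sum>z\<in>S. \<Sum>z'\<in>S. if z = z' then f z * g z * real N ^ CARD('n) else 0)"
  proof (intro sum.cong refl)
    fix z z' assume z: "z \<in> S" "z' \<in> S"
    then have "z - z' \<in> int_lattice" using assms(2) by (intro int_lattice_diff) auto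
    then show "f z * g z' * (\<Sum>m\<in>UNIV \<rightarrow>\<^sub>E {..<N}. cos ((z - z') \<bullet> torus_freq N m)) =
        (if z = z' then f z * g z * real N ^ CARD('n) else 0)"
      using torus_cos_sum[of N "z - z'"] small[OF z] \<open>0 < N\<close> by simp
  qed
  also have "\<dots> = real N ^ CARD('n) * (\<Sum>z\<in>S. f z * g z)"
    using \<open>finite S\<close> by (simp add: sum_distrib_left mult_ac)
  finally show ?thesis .
qed

text \<open>By bilinearity this is the scalar identity applied to each pair of entries of
  \<open>D\<close>, weighted with the entries of \<open>K\<close>.\<close>

lemma torus_parseval_tensor_form:
  fixes S :: "(real ^ 'n::finite) set" and D :: "real ^ 'n \<Rightarrow> 'n range_mat"
  assumes "finite S" "S \<subseteq> int_lattice" "0 < N"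
    and "\<And>z z' i. z \<in> S \<Longrightarrow> z' \<in> S \<Longrightarrow> \<bar>z $ i - z' $ i\<bar> < real N"
  shows "(\<Sum>m\<in>UNIV \<rightarrow>\<^sub>E {..<N}.
      tensor_form R K (\<lambda>j \<rho>. \<Sum>z\<in>S. D z j \<rho> * cos (z \<bullet> torus_freq N m))
        (\<lambda>j \<rho>. \<Sum>z\<in>S. D z j \<rho> * cos (z \<bullet> torus_freq N m)) +
      tensor_form R K (\<lambda>j \<rho>. \<Sum>z\<in>S. D z j \<rho> * sin (z \<bullet> torus_freq N m))
        (\<lambda>j \<rho>. \<Sum>z\<in>S. D z j \<rho> * sin (z \<bullet> torus_freq N m)))
    = real N ^ CARD('n) * (\<Sum>z\<in>S. tensor_form R K (D z) (D z))"
    (is "(\<Sum>m\<in>?T. tensor_form R K (?C m) (?C m) + tensor_form R K (?S m) (?S m)) = ?N * ?r")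
proof -
  have "(\<Sum>m\<in>?T. tensor_form R K (?C m) (?C m) + tensor_form R K (?S m) (?S m)) =
      (\<Sum>m\<in>?T. \<Sum>j\<in>UNIV. \<Sum>\<rho>\<in>R. \<Sum>l\<in>UNIV. \<Sum>\<sigma>\<in>R.
        K j \<rho> l \<sigma> * (?C m j \<rho> * ?C m l \<sigma> + ?S m j \<rho> * ?S m l \<sigma>))"
    by (simp only: tensor_form_def sum.distrib[symmetric] distrib_left mult.assoc)
  also have "\<dots> = (\<Sum>j\<in>UNIV. \<Sum>\<rho>\<in>R. \<Sum>l\<in>UNIV. \<Sum>\<sigma>\<in>R. \<Sum>m\<in>?T.
        K j \<rho> l \<sigma> * (?C m j \<rho> * ?C m l \<sigma> + ?S m j \<rho> * ?S m l \<sigma>))"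
    by (simp only: sum.swap[of _ _ ?T])
  also have "\<dots> = (\<Sum>j\<in>UNIV. \<Sum>\<rho>\<in>R. \<Sum>l\<in>UNIV. \<Sum>\<sigma>\<in>R. K j \<rho> l \<sigma> *
      (?N * (\<Sum>z\<in>S. D z j \<rho> * D z l \<sigma>)))"
    by (simp only: sum_distrib_left[symmetric] torus_parseval[OF assms])
  also have "\<dots> = (\<Sum>j\<in>UNIV. \<Sum>\<rho>\<in>R. \<Sum>l\<in>UNIV. \<Sum>\<sigma>\<in>R. \<Sum>z\<in>S. ?N * (K j \<rho> l \<sigma> * D z j \<rho> * D z l \<sigma>))"
    by (simp add: sum_distrib_left mult_ac)
  also have "\<dots> = (\<Sum>z\<in>S. \<Sum>j\<in>UNIV. \<Sum>\<rho>\<in>R. \<Sum>l\<in>UNIV. \<Sum>\<sigma>\<in>R. ?N * (K j \<rho> l \<sigma> * D z j \<rho> * D z l \<sigma>))"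
    by (simp only: sum.swap[of _ S])
  also have "\<dots> = ?N * ?r"
    by (simp only: tensor_form_def sum_distrib_left)
  finally show ?thesis .
qed

section \<open>From a nonnegative symbol to stability on the lattice\<close>

text \<open>Both sides are sums over the whole lattice in disguise, and those are invariant under
  translation by \<open>\<rho>\<close>.\<close>

lemma support_within_shift_sum:
  assumes "support_within R u S" "R \<subseteq> int_lattice" "\<rho> \<in> R"
  shows "(\<Sum>z\<in>S. u (z + \<rho>) $ j * h z) = (\<Sum>z\<in>S. u z $ j * h (z - \<rho>))"
proof -
  have fin: "finite S" and S: "S \<subseteq> int_lattice"
    and out: "\<And>z \<rho>. z \<in> int_lattice \<Longrightarrow> z \<notin> S \<Longrightarrow> \<rho> \<in> insert 0 R \<Longrightarrow> u (z + \<rho>) = 0"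
    using assms unfolding support_within_def by auto
  have \<rho>: "\<rho> \<in> int_lattice" using assms by auto
  have lat: "z + \<rho> \<in> int_lattice" "z - \<rho> \<in> int_lattice" if "z \<in> int_lattice" for z
    using that \<rho> by (auto intro: int_lattice_add int_lattice_diff)
  \<comment> \<open>The lattice point \<open>z + \<rho>\<close> lies outside \<open>S\<close>, where
    \<open>u\<close> itself vanishes: the shift 0 in \<open>support_within\<close>.\<close>
  have zero_right: "u (z + \<rho>) = 0" if "z \<in> S" "z + \<rho> \<notin> S" for z
    using out[of "z + \<rho>" 0] lat(1)[of z] S that by auto
  \<comment> \<open>Here \<open>z - \<rho>\<close> lies outside \<open>S\<close>, and
    \<open>z\<close> is its neighbour in direction \<open>\<rho>\<close>.\<close>
  have zero_left: "u z = 0" if "z \<in> S" "z - \<rho> \<notin> S" for z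
    using out[of "z - \<rho>" \<rho>] lat(2)[of z] S assms(3) that by auto
  have "(\<Sum>z\<in>S. u (z + \<rho>) $ j * h z) = (\<Sum>z\<in>{z \<in> S. z + \<rho> \<in> S}. u (z + \<rho>) $ j * h z)"
    using fin by (intro sum.mono_neutral_right) (auto simp: zero_right)
  also have "\<dots> = (\<Sum>z\<in>{z \<in> S. z - \<rho> \<in> S}. u z $ j * h (z - \<rho>))"
    by (rule sum.reindex_bij_witness[of _ "\<lambda>z. z - \<rho>" "\<lambda>z. z + \<rho>"]) auto
  also have "\<dots> = (\<Sum>z\<in>S. u z $ j * h (z - \<rho>))"
    using fin by (intro sum.mono_neutral_left) (auto simp: zero_left)
  finally show ?thesis .
qed

lemma symbol_form_zero: "symbol_form R K \<xi> 0 = 0"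
  by (simp add: symbol_form_def tensor_form_def outer_def cos_vec_def sin_vec_def)

lemma symbol_form_zero_left: "symbol_form R K 0 k = 0"
  by (simp add: symbol_form_def tensor_form_def outer_def)

text \<open>The Fourier coefficient of the gradient of \<open>u\<close> at frequency
  \<open>k\<close> is that of \<open>u\<close> times \<open>cos_vec k\<close> - i
  \<open>sin_vec k\<close>. Parseval's identity therefore writes the energy as an average of values
  of the symbol.\<close>

lemma lattice_stable_if_symbol_nonneg:
  fixes R :: "(real ^ 'n::finite) set" and K :: "'n range_tensor"
  assumes R: "R \<subseteq> int_lattice"
    and cross: "\<And>a b k. tensor_form R K (outer a (cos_vec k)) (outer b (sin_vec k)) =
         tensor_form R K (outer a (sin_vec k)) (outer b (cos_vec k))"
    and nonneg: "\<And>\<xi> k. \<forall>i. 0 \<le> k $ i \<and> k $ i < 2 * pi \<Longrightarrow> 0 \<le> symbol_form R K \<xi> k"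
  shows "lattice_stable R K"
  unfolding lattice_stable_def
proof (intro allI impI)
  fix u S assume u: "support_within R u S"
  then have fin: "finite S" and S: "S \<subseteq> int_lattice" by (auto simp: support_within_def)
  obtain B where B: "\<And>z. z \<in> S \<Longrightarrow> norm z \<le> B"
    using finite_imp_bounded[OF fin] unfolding bounded_iff by auto
  \<comment> \<open>Twice the radius bounds all coordinate differences in \<open>S\<close>. For
    empty \<open>S\<close> the bound \<open>B\<close> may be negative; the maximum with 0 still
    makes \<open>N\<close> positive.\<close>
  obtain N :: nat where N: "real N > max 0 (2 * B)" using reals_Archimedean2 by blast
  have small: "\<bar>z $ i - z' $ i\<bar> < real N" if "z \<in> S" "z' \<in> S" for z z' i
    using B[OF that(1)] B[OF that(2)] component_le_norm_cart[of z i] component_le_norm_cart[of z' i] N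
    by linarith
  have "0 < N" using N by simp
  let ?D = "discrete_grad 1 u"
  have "0 \<le> tensor_form R K (\<lambda>j \<rho>. \<Sum>z\<in>S. ?D z j \<rho> * cos (z \<bullet> k)) (\<lambda>j \<rho>. \<Sum>z\<in>S. ?D z j \<rho> * cos (z \<bullet> k)) +
      tensor_form R K (\<lambda>j \<rho>. \<Sum>z\<in>S. ?D z j \<rho> * sin (z \<bullet> k)) (\<lambda>j \<rho>. \<Sum>z\<in>S. ?D z j \<rho> * sin (z \<bullet> k))"
    (is "0 \<le> tensor_form R K ?C ?C + tensor_form R K ?S ?S")
    if k: "\<forall>i. 0 \<le> k $ i \<and> k $ i < 2 * pi" for k
  proof -
    \<comment> \<open>\<open>a\<close> and \<open>b\<close> are the real and imaginary parts of the
      sum of u(z) exp(i k z).\<close>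
    define a where "a = (\<chi> j. \<Sum>z\<in>S. u z $ j * cos (z \<bullet> k))"
    define b where "b = (\<chi> j. \<Sum>z\<in>S. u z $ j * sin (z \<bullet> k))"
    have C: "?C j \<rho> = outer a (cos_vec k) j \<rho> + outer b (sin_vec k) j \<rho>"
      and S: "?S j \<rho> = outer b (cos_vec k) j \<rho> - outer a (sin_vec k) j \<rho>" if "\<rho> \<in> R" for j \<rho>
    proof -
      have "?C j \<rho> = (\<Sum>z\<in>S. u (z + \<rho>) $ j * cos (z \<bullet> k)) - a $ j"
        by (simp add: discrete_grad_def a_def left_diff_distrib sum_subtractf)
      also have "(\<Sum>z\<in>S. u (z + \<rho>) $ j * cos (z \<bullet> k)) = a $ j * cos (\<rho> \<bullet> k) + b $ j * sin (\<rho> \<bullet> k)"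
        by (subst support_within_shift_sum[OF u R that])
          (simp add: a_def b_def inner_diff_left cos_diff distrib_left
            sum.distrib sum_distrib_left mult_ac)
      finally show "?C j \<rho> = outer a (cos_vec k) j \<rho> + outer b (sin_vec k) j \<rho>"
        by (simp add: outer_def cos_vec_def sin_vec_def algebra_simps)
      have "?S j \<rho> = (\<Sum>z\<in>S. u (z + \<rho>) $ j * sin (z \<bullet> k)) - b $ j"
        by (simp add: discrete_grad_def b_def left_diff_distrib sum_subtractf)
      also have "(\<Sum>z\<in>S. u (z + \<rho>) $ j * sin (z \<bullet> k)) = b $ j * cos (\<rho> \<bullet> k) - a $ j * sin (\<rho> \<bullet> k)"
        by (subst support_within_shift_sum[OF u R that])
          (simp add: a_def b_def inner_diff_left sin_diff right_diff_distrib
            sum_subtractf sum_distrib_left mult_ac)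
      finally show "?S j \<rho> = outer b (cos_vec k) j \<rho> - outer a (sin_vec k) j \<rho>"
        by (simp add: outer_def cos_vec_def sin_vec_def algebra_simps)
    qed
    have "tensor_form R K ?C ?C + tensor_form R K ?S ?S = symbol_form R K a k + symbol_form R K b k"
      using tensor_form_cong[OF C C, where K = K] tensor_form_cong[OF S S, where K = K]
        tensor_form_outer_combination[OF cross cross] by simp
    then show ?thesis using nonneg[OF k] by simp
  qed
  moreover have "\<forall>i. 0 \<le> torus_freq N m $ i \<and> torus_freq N m $ i < 2 * pi"
    if "m \<in> UNIV \<rightarrow>\<^sub>E {..<N}" for m :: "'n \<Rightarrow> nat"
    using that \<open>0 < N\<close> by (auto simp: torus_freq_def divide_less_eq PiE_iff)
  ultimately have "0 \<le> real N ^ CARD('n) * (\<Sum>z\<in>S. tensor_form R K (?D z) (?D z))"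
    by (subst torus_parseval_tensor_form[where R = R and K = K and D = "?D",
          OF fin S \<open>0 < N\<close> small, symmetric]) (auto intro!: sum_nonneg)
  then show "0 \<le> (\<Sum>z\<in>S. tensor_form R K (?D z) (?D z))"
    using mult_pos_neg[of "real N ^ CARD('n)"] \<open>0 < N\<close> by (meson not_le of_nat_0_less_iff zero_less_power)
qed

subsection \<open>Cut-off plane waves\<close>

text \<open>The half-open range in each coordinate makes the number of points exactly the power of
  the side length \<open>b - a\<close>.\<close>

definition lattice_box :: "int \<Rightarrow> int \<Rightarrow> (real ^ 'n::finite) set" where
  "lattice_box a b = (\<lambda>m. \<chi> i. real_of_int (m i)) ` (UNIV \<rightarrow>\<^sub>E {a..<b})"

lemma mem_lattice_box:
  "z \<in> lattice_box a b \<longleftrightarrow> z \<in> int_lattice \<and> (\<forall>i. real_of_int a \<le> z $ i \<and> z $ i < real_of_int b)"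
proof
  assume R: "z \<in> int_lattice \<and> (\<forall>i. real_of_int a \<le> z $ i \<and> z $ i < real_of_int b)"
  then have "z = (\<chi> i. real_of_int \<lfloor>z $ i\<rfloor>)" by (simp add: vec_eq_iff int_lattice_def)
  moreover have "(\<lambda>i. \<lfloor>z $ i\<rfloor>) \<in> UNIV \<rightarrow>\<^sub>E {a..<b}"
    using R by (auto simp: le_floor_iff floor_less_iff)
  ultimately show "z \<in> lattice_box a b" unfolding lattice_box_def by (rule image_eqI)
qed (auto simp: lattice_box_def int_lattice_def)

lemma lattice_box_mono: "a' \<le> a \<Longrightarrow> b \<le> b' \<Longrightarrow> lattice_box a b \<subseteq> lattice_box a' b'"
  unfolding lattice_box_def by (intro image_mono PiE_mono) auto

lemma finite_lattice_box: "finite (lattice_box a b)"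
  unfolding lattice_box_def by (intro finite_imageI finite_PiE) auto

lemma card_lattice_box: "card (lattice_box a b :: (real ^ 'n::finite) set) = nat (b - a) ^ CARD('n)"
proof -
  have "inj_on (\<lambda>m. \<chi> i. real_of_int (m i) :: real ^ 'n) A" for A
    by (auto simp: inj_on_def vec_eq_iff)
  then show ?thesis unfolding lattice_box_def by (simp add: card_image card_PiE)
qed

lemma finite_int_lattice_bounded:
  assumes "bounded A"
  shows "finite {z \<in> int_lattice. z \<in> A}"
proof -
  obtain B where B: "\<And>z. z \<in> A \<Longrightarrow> norm z \<le> B" using assms unfolding bounded_iff by auto
  \<comment> \<open>The upper end is raised by one because boxes are half-open.\<close>
  have "{z \<in> int_lattice. z \<in> A} \<subseteq> lattice_box (- \<lceil>B\<rceil>) (\<lceil>B\<rceil> + 1)"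
  proof
    fix z assume z: "z \<in> {z \<in> int_lattice. z \<in> A}"
    then have "\<bar>z $ i\<bar> \<le> B" for i
      using B[of z] component_le_norm_cart[of z i] by auto
    then have "- of_int \<lceil>B\<rceil> \<le> z $ i \<and> z $ i < of_int \<lceil>B\<rceil> + 1" for i
      using le_of_int_ceiling[of B] by (smt (verit, best))
    with z show "z \<in> lattice_box (- \<lceil>B\<rceil>) (\<lceil>B\<rceil> + 1)" by (simp add: mem_lattice_box)
  qed
  then show ?thesis by (rule finite_subset) (rule finite_lattice_box)
qed

text \<open>Crude but uniform: it bounds the energy at each point of the boundary layer by the same
  constant for all box sizes.\<close>

lemma abs_tensor_form_le:
  assumes "\<And>j \<rho>. \<rho> \<in> R \<Longrightarrow> \<bar>A j \<rho>\<bar> \<le> M" "\<And>j \<rho>. \<rho> \<in> R \<Longrightarrow> \<bar>B j \<rho>\<bar> \<le> M"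
  shows "\<bar>tensor_form R K A B\<bar> \<le> (\<Sum>j\<in>UNIV. \<Sum>\<rho>\<in>R. \<Sum>l\<in>UNIV. \<Sum>\<sigma>\<in>R. \<bar>K j \<rho> l \<sigma>\<bar> * M * M)"
  unfolding tensor_form_def
proof (intro sum_abs[THEN order_trans] sum_mono)
  fix j \<rho> l \<sigma> assume R: "\<rho> \<in> R" "\<sigma> \<in> R"
  have "0 \<le> M" using assms(1)[OF R(1), of j] by linarith
  then show "\<bar>K j \<rho> l \<sigma> * A j \<rho> * B l \<sigma>\<bar> \<le> \<bar>K j \<rho> l \<sigma>\<bar> * M * M"
    unfolding abs_mult using assms R by (intro mult_mono mult_nonneg_nonneg) auto
qed

lemma pow_ratio_tendsto_1:
  "(\<lambda>n. real (n + c) ^ d / real n ^ d) \<longlonglongrightarrow> 1"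
proof -
  have eq: "(1 + real c / real n) ^ d = real (n + c) ^ d / real n ^ d" if "0 < n" for n
    unfolding power_divide[symmetric] using that by (simp add: add_divide_distrib)
  have "(\<lambda>n. (1 + real c / real n) ^ d) \<longlonglongrightarrow> (1 + 0) ^ d"
    by (rule tendsto_power[OF tendsto_add[OF tendsto_const lim_const_over_n]])
  moreover have "eventually (\<lambda>n. (1 + real c / real n) ^ d = real (n + c) ^ d / real n ^ d) sequentially"
    using eventually_gt_at_top[of 0] by (rule eventually_mono) (rule eq)
  ultimately have "(\<lambda>n. real (n + c) ^ d / real n ^ d) \<longlonglongrightarrow> (1 + 0) ^ d"
    by (rule Lim_transform_eventually)
  then show ?thesis by simp
qed

text \<open>Stability is tested with the cut-off cosine and sine waves together. Dividing the sum of
  their energies by the volume of the box leaves the symbol and a boundary error that tends to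
  0.\<close>

lemma symbol_nonneg_if_lattice_stable:
  fixes R :: "(real ^ 'n::finite) set" and K :: "'n range_tensor"
  assumes finR: "finite R" and R: "R \<subseteq> int_lattice" and stable: "lattice_stable R K"
  shows "0 \<le> symbol_form R K \<xi> k"
proof -
  have "\<exists>r. \<forall>\<rho>\<in>R. \<forall>i. \<bar>\<rho> $ i\<bar> \<le> real r"
  proof -
    obtain B where B: "\<And>z. z \<in> R \<Longrightarrow> norm z \<le> B"
      using finite_imp_bounded[OF finR] unfolding bounded_iff by auto
    obtain r :: nat where "B \<le> real r" using real_arch_simple by blast
    then show ?thesis using B component_le_norm_cart order_trans by metis
  qed
  then obtain r where "\<forall>\<rho>\<in>R. \<forall>i. \<bar>\<rho> $ i\<bar> \<le> real r" by blast
  then have r: "\<bar>\<rho> $ i\<bar> \<le> real r" if "\<rho> \<in> insert 0 R" for \<rho> i using that by auto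
  \<comment> \<open>The outer 2 counts the two waves; \<open>2 * norm \<xi>\<close> bounds each
    difference of two values of norm at most \<open>norm \<xi>\<close>.\<close>
  define C where
    "C = 2 * (\<Sum>j\<in>UNIV. \<Sum>\<rho>\<in>R. \<Sum>l\<in>UNIV. \<Sum>\<sigma>\<in>R. \<bar>K j \<rho> l \<sigma>\<bar> * (2 * norm \<xi>) * (2 * norm \<xi>))"
  let ?d = "CARD('n)"
  have bound: "0 \<le> real n ^ ?d * symbol_form R K \<xi> k + (real (n + 4 * r) ^ ?d - real n ^ ?d) * C" for n
  proof -
    let ?r = "int r" and ?n = "int n"
    \<comment> \<open>The waves live on \<open>M\<close>. Gradients at points of \<open>I\<close>
      see only \<open>M\<close>, and every lattice point whose gradient can see \<open>M\<close>
      lies in \<open>S\<close>. Each step widens the box by \<open>r\<close> on both sides, so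
      \<open>S\<close> has side \<open>n + 4 * r\<close>.\<close>
    define I M S where "I = (lattice_box 0 ?n :: (real ^ 'n) set)"
      and "M = (lattice_box (- ?r) (?n + ?r) :: (real ^ 'n) set)"
      and "S = (lattice_box (- ?r - ?r) (?n + ?r + ?r) :: (real ^ 'n) set)"
    define u v where "u = (\<lambda>z. if z \<in> M then cos (z \<bullet> k) *\<^sub>R \<xi> else 0)"
      and "v = (\<lambda>z. if z \<in> M then sin (z \<bullet> k) *\<^sub>R \<xi> else 0)"
    let ?f = "\<lambda>w z. tensor_form R K (discrete_grad 1 w z) (discrete_grad 1 w z)"
    have shift: "z \<in> lattice_box (a - ?r) (b + ?r)"
      if "z + \<rho> \<in> lattice_box a b" "z \<in> int_lattice" "\<rho> \<in> insert 0 R" for z \<rho> :: "real ^ 'n" and a b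
      unfolding mem_lattice_box
    proof (intro conjI allI)
      fix i
      have "real_of_int a \<le> z $ i + \<rho> $ i \<and> z $ i + \<rho> $ i < real_of_int b"
        using that(1) by (auto simp: mem_lattice_box)
      with r[OF that(3), of i] show "real_of_int (a - ?r) \<le> z $ i" "z $ i < real_of_int (b + ?r)"
        by auto
    qed (rule that(2))
    have finS: "finite S" unfolding S_def by (rule finite_lattice_box)
    have "I \<subseteq> S" unfolding I_def S_def by (rule lattice_box_mono) auto
    have "support_within R w S" if "\<And>z. z \<notin> M \<Longrightarrow> w z = 0" for w
      unfolding support_within_def
    proof (intro conjI ballI)
      fix z \<rho> assume z: "z \<in> int_lattice - S" "\<rho> \<in> insert 0 R"
      with shift[of z \<rho> "- ?r" "?n + ?r"] have "z + \<rho> \<notin> M" unfolding M_def S_def by blast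
      with that show "w (z + \<rho>) = 0" by blast
    qed (auto simp: S_def finite_lattice_box mem_lattice_box)
    then have "support_within R u S" "support_within R v S" by (simp_all add: u_def v_def)
    with stable have "0 \<le> (\<Sum>z\<in>S. ?f u z) + (\<Sum>z\<in>S. ?f v z)"
      unfolding lattice_stable_def by (intro add_nonneg_nonneg) blast+
    also have "\<dots> = (\<Sum>z\<in>S. ?f u z + ?f v z)" by (simp add: sum.distrib)
    also have "\<dots> = (\<Sum>z\<in>S - I. ?f u z + ?f v z) + (\<Sum>z\<in>I. ?f u z + ?f v z)"
      by (rule sum.subset_diff[OF \<open>I \<subseteq> S\<close> finS])
    also have "(\<Sum>z\<in>I. ?f u z + ?f v z) = (\<Sum>z\<in>I. symbol_form R K \<xi> k)"
    proof (rule sum.cong[OF refl])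
      fix z assume z: "z \<in> I"
      have M: "z + \<rho> \<in> M" if "\<rho> \<in> insert 0 R" for \<rho>
        unfolding M_def mem_lattice_box
      proof (intro conjI allI)
        fix i
        have "0 \<le> z $ i \<and> z $ i < real n" using z by (auto simp: I_def mem_lattice_box)
        with r[OF that, of i] show "real_of_int (- ?r) \<le> (z + \<rho>) $ i" "(z + \<rho>) $ i < real_of_int (?n + ?r)"
          by auto
      qed (use z R that in \<open>auto simp: I_def mem_lattice_box intro: int_lattice_add\<close>)
      let ?c = "outer \<xi> (cos_vec k)" and ?s = "outer \<xi> (sin_vec k)"
      let ?\<alpha> = "cos (z \<bullet> k)" and ?\<beta> = "sin (z \<bullet> k)"
      \<comment> \<open>By the addition theorems the pair of gradients is the pair of
        \<open>?c\<close> and \<open>?s\<close> rotated by the angle z k.\<close>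
      have "discrete_grad 1 u z j \<rho> = ?\<alpha> * ?c j \<rho> - ?\<beta> * ?s j \<rho>"
        and "discrete_grad 1 v z j \<rho> = ?\<beta> * ?c j \<rho> + ?\<alpha> * ?s j \<rho>" if "\<rho> \<in> R" for j \<rho>
        using M[of \<rho>] M[of 0] that
        by (simp_all add: discrete_grad_def u_def v_def outer_def cos_vec_def sin_vec_def
            inner_add_left cos_add sin_add algebra_simps)
      then have "?f u z = tensor_form R K (\<lambda>j \<rho>. ?\<alpha> * ?c j \<rho> - ?\<beta> * ?s j \<rho>) (\<lambda>j \<rho>. ?\<alpha> * ?c j \<rho> - ?\<beta> * ?s j \<rho>)"
        and "?f v z = tensor_form R K (\<lambda>j \<rho>. ?\<beta> * ?c j \<rho> + ?\<alpha> * ?s j \<rho>) (\<lambda>j \<rho>. ?\<beta> * ?c j \<rho> + ?\<alpha> * ?s j \<rho>)"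
        by (auto intro!: tensor_form_cong)
      \<comment> \<open>The mixed terms of the two energies have opposite signs and cancel, so the
        sum no longer depends on \<open>z\<close>.\<close>
      then have "?f u z + ?f v z = (?\<alpha>\<^sup>2 + ?\<beta>\<^sup>2) * symbol_form R K \<xi> k"
        unfolding tensor_form_bilinear symbol_form_def by algebra
      then show "?f u z + ?f v z = symbol_form R K \<xi> k" by simp
    qed
    also have "\<dots> = real n ^ ?d * symbol_form R K \<xi> k"
      by (simp add: I_def card_lattice_box)
    also have "(\<Sum>z\<in>S - I. ?f u z + ?f v z) \<le> real (card (S - I)) * C"
    proof (rule sum_bounded_above)
      fix z
      have le: "?f w z \<le> (\<Sum>j\<in>UNIV. \<Sum>\<rho>\<in>R. \<Sum>l\<in>UNIV. \<Sum>\<sigma>\<in>R. \<bar>K j \<rho> l \<sigma>\<bar> * (2 * norm \<xi>) * (2 * norm \<xi>))"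
        if "\<And>z. norm (w z) \<le> norm \<xi>" for w
      proof -
        have "\<bar>discrete_grad 1 w z j \<rho>\<bar> \<le> 2 * norm \<xi>" for j \<rho>
          using component_le_norm_cart[of "w (z + \<rho>) - w z" j] norm_triangle_ineq4[of "w (z + \<rho>)" "w z"]
            that[of z] that[of "z + \<rho>"] by (simp add: discrete_grad_def)
        then show ?thesis by (intro order_trans[OF abs_ge_self abs_tensor_form_le])
      qed
      have "norm (u z) \<le> norm \<xi>" "norm (v z) \<le> norm \<xi>" for z
        by (auto simp: u_def v_def intro!: mult_left_le_one_le)
      then show "?f u z + ?f v z \<le> C" using le[of u] le[of v] by (simp add: C_def)
    qed
    also have "real (card (S - I)) = real (n + 4 * r) ^ ?d - real n ^ ?d"
    proof -
      have "nat (?n + ?r + ?r - (- ?r - ?r)) = n + 4 * r" by linarith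
      then have card: "card S = (n + 4 * r) ^ ?d" "card I = n ^ ?d"
        by (simp_all only: S_def I_def card_lattice_box diff_zero nat_int)
      have "card (S - I) = card S - card I"
        using \<open>I \<subseteq> S\<close> finS by (intro card_Diff_subset) (auto intro: finite_subset)
      moreover have "card I \<le> card S" using \<open>I \<subseteq> S\<close> finS by (rule card_mono[rotated])
      ultimately show ?thesis by (simp add: of_nat_diff card)
    qed
    finally show ?thesis by simp
  qed
  \<comment> \<open>The boundary layer has lower order than the volume, so its relative size tends
    to \<open>1 - 1\<close>.\<close>
  have "(\<lambda>n. symbol_form R K \<xi> k + (real (n + 4 * r) ^ ?d / real n ^ ?d - 1) * C)
      \<longlonglongrightarrow> symbol_form R K \<xi> k + (1 - 1) * C"
    by (intro tendsto_intros pow_ratio_tendsto_1)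
  moreover have "eventually (\<lambda>n. 0 \<le> symbol_form R K \<xi> k + (real (n + 4 * r) ^ ?d / real n ^ ?d - 1) * C) sequentially"
    using eventually_gt_at_top[of 0]
  proof eventually_elim
    case (elim n)
    then have "real n ^ ?d > 0" by simp
    with bound[of n] have "0 \<le> (real n ^ ?d * symbol_form R K \<xi> k
        + (real (n + 4 * r) ^ ?d - real n ^ ?d) * C) / real n ^ ?d" by (intro divide_nonneg_pos)
    also have "\<dots> = symbol_form R K \<xi> k + (real (n + 4 * r) ^ ?d / real n ^ ?d - 1) * C"
      using \<open>real n ^ ?d > 0\<close> by (simp add: add_divide_distrib diff_divide_distrib left_diff_distrib del: of_nat_add)
    finally show ?case .
  qed
  ultimately have "0 \<le> symbol_form R K \<xi> k + (1 - 1) * C"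
    by (rule tendsto_lowerbound) simp
  then show ?thesis by simp
qed

subsection \<open>Rescaling to a bounded domain\<close>

text \<open>Otherwise \<open>k\<close> pairs with every element of \<open>R\<close> to a multiple of
  2 pi. The vectors with this property form an integer submodule \<open>V\<close>, which then
  contains the whole lattice. The unit vectors show that each coordinate of \<open>k\<close> is a
  multiple of 2 pi, and in the half-open cube only 0 is.\<close>

lemma symbol_denominator_pos:
  fixes R :: "(real ^ 'n::finite) set"
  assumes "finite R" and span: "int_span R = int_lattice"
    and k: "\<forall>i. 0 \<le> k $ i \<and> k $ i < 2 * pi" and "k \<noteq> 0"
  shows "0 < vec_norm_sq R (cos_vec k) + vec_norm_sq R (sin_vec k)"
proof (rule ccontr)
  assume "\<not> ?thesis"
  moreover have "0 \<le> vec_norm_sq R (cos_vec k)" "0 \<le> vec_norm_sq R (sin_vec k)"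
    by (simp_all add: vec_norm_sq_def sum_nonneg)
  ultimately have "vec_norm_sq R (cos_vec k) = 0" by linarith
  then have cos1: "cos (\<rho> \<bullet> k) = 1" if "\<rho> \<in> R" for \<rho>
    using that \<open>finite R\<close> by (auto simp: vec_norm_sq_def sum_nonneg_eq_0_iff cos_vec_def)
  define V where "V = {v. \<exists>n::int. v \<bullet> k = real_of_int n * (2 * pi)}"
  have "R \<subseteq> V"
    using cos1 by (fastforce simp: V_def cos_one_2pi_int mult.assoc)
  moreover have "module.subspace (\<lambda>(n::int) v. of_int n *\<^sub>R v) V"
    unfolding module.subspace_def[OF module_int_scale]
  proof (intro conjI ballI allI)
    show "0 \<in> V" by (auto simp: V_def intro: exI[of _ 0])
  next
    fix x y assume "x \<in> V" "y \<in> V"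
    then obtain m n :: int where "x \<bullet> k = real_of_int m * (2 * pi)" "y \<bullet> k = real_of_int n * (2 * pi)"
      by (auto simp: V_def)
    then have "(x + y) \<bullet> k = real_of_int (m + n) * (2 * pi)"
      by (simp add: inner_add_left algebra_simps)
    then show "x + y \<in> V" unfolding V_def by blast
  next
    fix c :: int and x assume "x \<in> V"
    then obtain m :: int where "x \<bullet> k = real_of_int m * (2 * pi)" by (auto simp: V_def)
    then have "(of_int c *\<^sub>R x) \<bullet> k = real_of_int (c * m) * (2 * pi)" by simp
    then show "of_int c *\<^sub>R x \<in> V" unfolding V_def by blast
  qed
  ultimately have "int_lattice \<subseteq> V"
    unfolding span[symmetric] int_span_def by (rule module.span_minimal[OF module_int_scale])
  have "k $ i = 0" for i
  proof -
    have "axis i 1 \<in> (int_lattice :: (real ^ 'n) set)" by (auto simp: int_lattice_def axis_def)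
    with \<open>int_lattice \<subseteq> V\<close> obtain n :: int where n: "k $ i = real_of_int n * (2 * pi)"
      by (auto simp: V_def inner_axis')
    with k have "0 \<le> real_of_int n * (2 * pi)" "real_of_int n * (2 * pi) < 1 * (2 * pi)"
      by (metis, metis mult_1)
    then have "0 \<le> real_of_int n" "real_of_int n < 1"
      using pi_gt_zero by (auto simp: zero_le_mult_iff)
    then have "n = 0" by linarith
    with n show ?thesis by simp
  qed
  then show False using \<open>k \<noteq> 0\<close> by (simp add: vec_eq_iff)
qed

text \<open>A segment leaving \<open>A\<close> crosses the frontier at a point no farther from
  \<open>p\<close> than \<open>x\<close> is.\<close>

lemma mem_of_dist_less_infdist_frontier:
  fixes p x :: "'a::euclidean_space"
  assumes "p \<in> A" "dist p x < infdist p (frontier A)"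
  shows "x \<in> A"
proof (rule ccontr)
  assume "x \<notin> A"
  then have "closed_segment p x \<inter> frontier A \<noteq> {}"
    using assms(1) by (intro connected_Int_frontier) auto
  then obtain q where q: "q \<in> closed_segment p x" "q \<in> frontier A" by blast
  have "infdist p (frontier A) \<le> dist p q" using q(2) by (rule infdist_le)
  also have "\<dots> \<le> dist p x" using q(1) dist_in_closed_segment(1)[of q p x] by (simp add: dist_commute)
  finally show False using assms(2) by simp
qed

text \<open>The frontier of an open set misses the set, hence also the ball, so all its points are
  at least \<open>r\<close> away from \<open>c\<close>. It has to be nonempty because
  \<open>infdist\<close> to the empty set is 0.\<close>

lemma ball_subset_infdist_frontier:
  fixes x :: "'a::euclidean_space"
  assumes "ball c r \<subseteq> A" "open A" "frontier A \<noteq> {}"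
  shows "r - dist c x \<le> infdist x (frontier A)"
  unfolding infdist_notempty[OF assms(3)]
proof (rule cINF_greatest[OF assms(3)])
  fix q assume "q \<in> frontier A"
  then have "q \<notin> A" using \<open>open A\<close> by (simp add: frontier_def interior_open)
  then have "r \<le> dist c q" using assms(1) by (meson in_mono mem_ball not_le)
  then show "r - dist c x \<le> dist x q" using dist_triangle[of c q x] by linarith
qed

lemma norm_le_R0: "finite R \<Longrightarrow> \<rho> \<in> R \<Longrightarrow> norm \<rho> \<le> R0 R"
  unfolding R0_def by (intro max.coboundedI1 Max_ge) auto

lemma R0_nonneg: "0 \<le> R0 R"
  unfolding R0_def by (intro max.coboundedI2) simp

text \<open>Off the intersection of the two windows \<open>u\<close> vanishes at the point and all
  its neighbours, and with it \<open>g\<close>. This allows a change of window for energies.\<close>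

lemma support_within_sum_eq:
  assumes "support_within R u S" "support_within R u S'"
    and "\<And>z. z \<in> int_lattice \<Longrightarrow> (\<And>\<rho>. \<rho> \<in> insert 0 R \<Longrightarrow> u (z + \<rho>) = 0) \<Longrightarrow> g z = 0"
  shows "sum g S = sum g S'"
proof -
  have g: "g z = 0" if "z \<in> int_lattice" "z \<notin> S \<inter> S'" for z
  proof (rule assms(3)[OF that(1)])
    fix \<rho> assume "\<rho> \<in> insert 0 R"
    with that assms(1,2) show "u (z + \<rho>) = 0" unfolding support_within_def by blast
  qed
  have fin: "finite S" "finite S'" and lat: "S \<subseteq> int_lattice" "S' \<subseteq> int_lattice"
    using assms(1,2) by (auto simp: support_within_def)
  have "sum g S = sum g (S \<inter> S')"
    using fin lat g by (intro sum.mono_neutral_right) auto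
  moreover have "sum g S' = sum g (S \<inter> S')"
    using fin lat g by (intro sum.mono_neutral_right) auto
  ultimately show ?thesis by simp
qed

lemma discrete_grad_eq_0:
  "u z = 0 \<Longrightarrow> u (z + \<rho>) = 0 \<Longrightarrow> discrete_grad 1 u z j \<rho> = 0"
  by (simp add: discrete_grad_def)

lemma tensor_form_grad_eq_0:
  assumes "\<And>\<rho>. \<rho> \<in> insert 0 R \<Longrightarrow> u (z + \<rho>) = 0"
  shows "tensor_form R K (discrete_grad 1 u z) (discrete_grad 1 u z) = 0"
proof -
  have "tensor_form R K (discrete_grad 1 u z) (discrete_grad 1 u z) =
      tensor_form R K (\<lambda>j \<rho>. 0) (\<lambda>j \<rho>. 0)"
    using assms assms[of 0] by (intro tensor_form_cong discrete_grad_eq_0) auto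
  then show ?thesis by (simp add: tensor_form_def)
qed

section \<open>Passing between a bounded domain and the unit lattice\<close>

text \<open>The unspecified values of \<open>y\<close> off its domain are replaced by 0, which gives
  a function to which \<open>support_within\<close> can apply.\<close>

definition pull_back ::
    "real \<Rightarrow> (real ^ 'n) set \<Rightarrow> (real ^ 'n \<Rightarrow> real ^ 'n) \<Rightarrow> real ^ 'n \<Rightarrow> real ^ 'n" where
  "pull_back \<epsilon> \<Omega> y = (\<lambda>z. if z \<in> int_lattice \<and> \<epsilon> *\<^sub>R z \<in> \<Omega> then y (\<epsilon> *\<^sub>R z) else 0)"

definition pull_back_sint :: "(real ^ 'n::finite) set \<Rightarrow> real \<Rightarrow> (real ^ 'n) set \<Rightarrow> (real ^ 'n) set" where
  "pull_back_sint R \<epsilon> \<Omega> = {z \<in> int_lattice. \<epsilon> *\<^sub>R z \<in> sint R \<epsilon> \<Omega>}"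

lemma sint_eq_image: "sint R \<epsilon> \<Omega> = (\<lambda>z. \<epsilon> *\<^sub>R z) ` pull_back_sint R \<epsilon> \<Omega>"
  unfolding pull_back_sint_def by (auto simp: sint_def scaled_lattice_def)

lemma finite_pull_back_sint:
  assumes "0 < \<epsilon>" "bounded \<Omega>"
  shows "finite (pull_back_sint R \<epsilon> \<Omega>)"
proof -
  have "bounded ((\<lambda>x. (1 / \<epsilon>) *\<^sub>R x) ` \<Omega>)" using assms(2) by (rule bounded_scaling)
  from finite_int_lattice_bounded[OF this] show ?thesis
  proof (rule finite_subset[rotated], intro subsetI)
    fix z assume "z \<in> pull_back_sint R \<epsilon> \<Omega>"
    then have "z \<in> int_lattice" "\<epsilon> *\<^sub>R z \<in> \<Omega>" by (auto simp: pull_back_sint_def sint_def)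
    moreover from this(2) have "z \<in> (\<lambda>x. (1 / \<epsilon>) *\<^sub>R x) ` \<Omega>"
      using assms(1) by (intro image_eqI[of _ _ "\<epsilon> *\<^sub>R z"]) auto
    ultimately show "z \<in> {z \<in> int_lattice. z \<in> (\<lambda>x. (1 / \<epsilon>) *\<^sub>R x) ` \<Omega>}" by simp
  qed
qed

context
  fixes R \<Omega> :: "(real ^ 'n::finite) set" and \<epsilon> :: real
  assumes finR: "finite R" and R: "R \<subseteq> int_lattice" and \<Omega>: "bounded \<Omega>" and \<epsilon>: "0 < \<epsilon>"
begin

text \<open>The factor 2 in \<open>admissible\<close> is used here. A nonzero value sits farther
  than \<open>2 * \<epsilon> * R0 R\<close> from the frontier, and a step by
  \<open>\<epsilon> *\<^sub>R \<rho>\<close> costs at most \<open>\<epsilon> * R0 R\<close>, so the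
  point whose gradient sees this value still belongs to \<open>sint\<close>.\<close>

lemma support_within_pull_back:
  assumes y: "y \<in> admissible R \<epsilon> \<Omega>"
  shows "support_within R (pull_back \<epsilon> \<Omega> y) (pull_back_sint R \<epsilon> \<Omega>)"
  unfolding support_within_def
proof (intro conjI ballI)
  fix z \<rho> assume z: "z \<in> int_lattice - pull_back_sint R \<epsilon> \<Omega>" and \<rho>: "\<rho> \<in> insert 0 R"
  show "pull_back \<epsilon> \<Omega> y (z + \<rho>) = 0"
  proof (rule ccontr)
    let ?p = "\<epsilon> *\<^sub>R (z + \<rho>)" and ?x = "\<epsilon> *\<^sub>R z"
    assume "pull_back \<epsilon> \<Omega> y (z + \<rho>) \<noteq> 0"
    then have p: "z + \<rho> \<in> int_lattice" "?p \<in> \<Omega>" "y ?p \<noteq> 0"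
      by (auto simp: pull_back_def split: if_splits)
    then have "?p \<in> \<Omega> \<inter> scaled_lattice \<epsilon>" by (auto simp: scaled_lattice_def)
    with y have "infdist ?p (frontier \<Omega>) \<le> 2 * \<epsilon> * R0 R \<longrightarrow> y ?p = 0"
      unfolding admissible_def by blast
    with p(3) have far: "2 * \<epsilon> * R0 R < infdist ?p (frontier \<Omega>)" by (simp add: not_le)
    have "norm \<rho> \<le> R0 R" using \<rho> norm_le_R0[OF finR] R0_nonneg by auto
    then have close: "dist ?p ?x \<le> \<epsilon> * R0 R"
      using \<epsilon> by (simp add: dist_norm scaleR_add_right)
    also have "\<dots> \<le> 2 * \<epsilon> * R0 R" using \<epsilon> R0_nonneg[of R] by simp
    finally have "?x \<in> \<Omega>" using far mem_of_dist_less_infdist_frontier[OF p(2), of ?x] by auto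
    moreover have "\<epsilon> * R0 R < infdist ?x (frontier \<Omega>)"
      using far close infdist_triangle[of ?p "frontier \<Omega>" ?x] by (simp add: algebra_simps)
    ultimately have "z \<in> pull_back_sint R \<epsilon> \<Omega>"
      using z by (auto simp: pull_back_sint_def sint_def scaled_lattice_def)
    with z show False by simp
  qed
qed (auto simp: finite_pull_back_sint[OF \<epsilon> \<Omega>], simp add: pull_back_sint_def)

text \<open>At points of \<open>sint\<close> all neighbours lie in \<open>\<Omega>\<close>, so the
  extension by 0 is not seen and only the factor from the change of spacing remains.\<close>

lemma discrete_grad_pull_back:
  assumes "z \<in> pull_back_sint R \<epsilon> \<Omega>" "\<rho> \<in> R"
  shows "discrete_grad \<epsilon> y (\<epsilon> *\<^sub>R z) j \<rho> = (1 / \<epsilon>) * discrete_grad 1 (pull_back \<epsilon> \<Omega> y) z j \<rho>"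
proof -
  have z: "z \<in> int_lattice" "\<epsilon> *\<^sub>R z \<in> \<Omega>" "\<epsilon> * R0 R < infdist (\<epsilon> *\<^sub>R z) (frontier \<Omega>)"
    using assms(1) by (auto simp: pull_back_sint_def sint_def)
  have "dist (\<epsilon> *\<^sub>R z) (\<epsilon> *\<^sub>R (z + \<rho>)) \<le> \<epsilon> * R0 R"
    using norm_le_R0[OF finR assms(2)] \<epsilon> by (simp add: dist_norm scaleR_add_right)
  with z(3) have "\<epsilon> *\<^sub>R (z + \<rho>) \<in> \<Omega>"
    using mem_of_dist_less_infdist_frontier[OF z(2), of "\<epsilon> *\<^sub>R (z + \<rho>)"] by auto
  moreover have "z + \<rho> \<in> int_lattice" using z(1) R assms(2) by (auto intro: int_lattice_add)
  ultimately show ?thesis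
    using z by (simp add: discrete_grad_def pull_back_def scaleR_add_right divide_inverse)
qed

lemma sum_tensor_form_pull_back:
  "(\<Sum>x\<in>sint R \<epsilon> \<Omega>. tensor_form R K (discrete_grad \<epsilon> y x) (discrete_grad \<epsilon> y x)) =
   (1 / \<epsilon>)\<^sup>2 * (\<Sum>z\<in>pull_back_sint R \<epsilon> \<Omega>. tensor_form R K
      (discrete_grad 1 (pull_back \<epsilon> \<Omega> y) z) (discrete_grad 1 (pull_back \<epsilon> \<Omega> y) z))"
proof -
  have "tensor_form R K (discrete_grad \<epsilon> y (\<epsilon> *\<^sub>R z)) (discrete_grad \<epsilon> y (\<epsilon> *\<^sub>R z)) =
      (1 / \<epsilon>)\<^sup>2 * tensor_form R K
        (discrete_grad 1 (pull_back \<epsilon> \<Omega> y) z) (discrete_grad 1 (pull_back \<epsilon> \<Omega> y) z)"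
    if "z \<in> pull_back_sint R \<epsilon> \<Omega>" for z
    by (subst tensor_form_cong[OF discrete_grad_pull_back[OF that] discrete_grad_pull_back[OF that]])
      (simp_all only: tensor_form_bilinear power2_eq_square mult.assoc)
  moreover have "inj_on (\<lambda>z. \<epsilon> *\<^sub>R z) (pull_back_sint R \<epsilon> \<Omega>)" using \<epsilon> by (auto simp: inj_on_def)
  ultimately show ?thesis by (simp add: sint_eq_image sum.reindex sum_distrib_left)
qed

text \<open>If all gradients vanished, a nonzero value would propagate along the ray in some
  direction \<open>\<rho> \<noteq> 0\<close> of \<open>R\<close>, giving infinitely many points in a
  finite set. Positivity permits clearing the denominator of the quotient.\<close>

lemma mat_norm_sq_pos:
  assumes "0 \<notin> R" "R \<noteq> {}" and y: "y \<in> admissible R \<epsilon> \<Omega>"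
    and nz: "\<exists>x \<in> \<Omega> \<inter> scaled_lattice \<epsilon>. y x \<noteq> 0"
  shows "0 < (\<Sum>x\<in>sint R \<epsilon> \<Omega>. mat_norm_sq R (discrete_grad \<epsilon> y x))"
proof (rule ccontr)
  let ?u = "pull_back \<epsilon> \<Omega> y" and ?S = "pull_back_sint R \<epsilon> \<Omega>"
  have fin: "finite ?S" using finite_pull_back_sint[OF \<epsilon> \<Omega>] .
  have u: "support_within R ?u ?S" using support_within_pull_back[OF y] .
  obtain z where z: "z \<in> int_lattice" "?u z \<noteq> 0"
    using nz by (auto simp: scaled_lattice_def pull_back_def)
  obtain \<rho> where \<rho>: "\<rho> \<in> R" using \<open>R \<noteq> {}\<close> by blast
  assume "\<not> ?thesis"
  then have "(\<Sum>x\<in>sint R \<epsilon> \<Omega>. mat_norm_sq R (discrete_grad \<epsilon> y x)) = 0"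
    using sum_nonneg[of "sint R \<epsilon> \<Omega>" "\<lambda>x. mat_norm_sq R (discrete_grad \<epsilon> y x)"]
    by (simp add: mat_norm_sq_nonneg)
  then have "mat_norm_sq R (discrete_grad \<epsilon> y (\<epsilon> *\<^sub>R z)) = 0" if "z \<in> ?S" for z
    using that fin unfolding sint_eq_image
    by (subst (asm) sum_nonneg_eq_0_iff) (auto simp: mat_norm_sq_nonneg)
  then have "discrete_grad \<epsilon> y (\<epsilon> *\<^sub>R z) j \<rho> = 0" if "z \<in> ?S" for z j
    using that \<rho> finR by (fastforce simp: mat_norm_sq_def sum_nonneg_eq_0_iff sum_nonneg)
  then have "discrete_grad 1 ?u z j \<rho> = 0" if "z \<in> ?S" for z j
    using that discrete_grad_pull_back[OF that \<rho>, of y j] \<epsilon> by auto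
  then have const: "?u (z + \<rho>) = ?u z" if "z \<in> ?S" for z
    using that by (simp add: discrete_grad_def vec_eq_iff)
  have in_S: "z \<in> ?S" if "z \<in> int_lattice" "?u z \<noteq> 0" for z
  proof (rule ccontr)
    assume "z \<notin> ?S"
    with that u have "?u (z + 0) = 0" unfolding support_within_def by blast
    with that show False by simp
  qed
  \<comment> \<open>A nonzero value places the point in \<open>?S\<close>, where the vanishing
    gradient carries the value on to the next point.\<close>
  have "z + real n *\<^sub>R \<rho> \<in> int_lattice \<and> ?u (z + real n *\<^sub>R \<rho>) \<noteq> 0" for n
  proof (induction n)
    case (Suc n)
    have eq: "z + real (Suc n) *\<^sub>R \<rho> = (z + real n *\<^sub>R \<rho>) + \<rho>" by (simp add: algebra_simps)
    show ?case unfolding eq using Suc const[OF in_S] \<rho> R by (auto intro: int_lattice_add)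
  qed (use z in simp)
  then have "range (\<lambda>n. z + real n *\<^sub>R \<rho>) \<subseteq> ?S" using in_S by blast
  then have "finite (range (\<lambda>n. z + real n *\<^sub>R \<rho>))" using fin finite_subset by blast
  moreover have "inj (\<lambda>n. z + real n *\<^sub>R \<rho>)" using \<rho> \<open>0 \<notin> R\<close> by (auto simp: inj_on_def)
  ultimately show False using finite_imageD infinite_UNIV_nat by blast
qed

text \<open>Clearing the positive denominator leaves the sign of \<open>?Q - L * ?N\<close>, which
  is the energy for the shifted tensor up to the positive factor
  \<open>(1 / \<epsilon>)\<^sup>2\<close>.\<close>

lemma le_quotient_iff:
  assumes "0 \<notin> R" "R \<noteq> {}" "y \<in> admissible R \<epsilon> \<Omega>" "\<exists>x \<in> \<Omega> \<inter> scaled_lattice \<epsilon>. y x \<noteq> 0"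
  shows "L \<le> (\<Sum>x\<in>sint R \<epsilon> \<Omega>. tensor_form R K (discrete_grad \<epsilon> y x) (discrete_grad \<epsilon> y x)) /
               (\<Sum>x\<in>sint R \<epsilon> \<Omega>. mat_norm_sq R (discrete_grad \<epsilon> y x)) \<longleftrightarrow>
     0 \<le> (\<Sum>z\<in>pull_back_sint R \<epsilon> \<Omega>. tensor_form R (shift_tensor K L)
      (discrete_grad 1 (pull_back \<epsilon> \<Omega> y) z) (discrete_grad 1 (pull_back \<epsilon> \<Omega> y) z))"
    (is "L \<le> ?Q / ?N \<longleftrightarrow> 0 \<le> ?E")
proof -
  have "?Q - L * ?N =
      (\<Sum>x\<in>sint R \<epsilon> \<Omega>. tensor_form R (shift_tensor K L) (discrete_grad \<epsilon> y x) (discrete_grad \<epsilon> y x))"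
    by (simp add: tensor_form_shift[OF finR] sum_subtractf sum_distrib_left)
  also have "\<dots> = (1 / \<epsilon>)\<^sup>2 * ?E" by (rule sum_tensor_form_pull_back)
  finally have "0 \<le> ?Q - L * ?N \<longleftrightarrow> 0 \<le> ?E" using \<epsilon> by (simp add: zero_le_mult_iff)
  then show ?thesis using mat_norm_sq_pos[OF assms] by (simp add: le_divide_eq)
qed

end

text \<open>A small enough spacing fits a copy of the support of \<open>u\<close>, with the margin
  required by \<open>admissible\<close>, into a ball inside \<open>\<Omega>\<close>. The shift
  \<open>p\<close> appears because the copy must sit on lattice points while the centre of the ball
  need not be one.\<close>

lemma rescaled_test_function:
  fixes R \<Omega> :: "(real ^ 'n::finite) set"
  assumes \<Omega>: "open \<Omega>" "bounded \<Omega>" "\<Omega> \<noteq> {}" and u: "support_within R u S"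
  obtains \<epsilon> y p where "0 < \<epsilon>" "y \<in> admissible R \<epsilon> \<Omega>" "p \<in> int_lattice"
    "\<And>z. z \<in> int_lattice \<Longrightarrow> pull_back \<epsilon> \<Omega> y z = u (z - p)"
proof -
  have fin: "finite S" and out: "\<And>z. z \<in> int_lattice \<Longrightarrow> u z \<noteq> 0 \<Longrightarrow> z \<in> S"
    using u unfolding support_within_def by (blast, metis DiffI add.right_neutral insertI1)
  obtain c r where r: "0 < r" "ball c r \<subseteq> \<Omega>"
    using \<Omega>(1,3) open_contains_ball by (metis ex_in_conv)
  obtain B where B: "0 < B" "\<And>z. z \<in> S \<Longrightarrow> norm z \<le> B"
    using finite_imp_bounded[OF fin] unfolding bounded_pos by auto
  define d where "d = real CARD('n)"
  \<comment> \<open>In units of \<open>\<epsilon>\<close>: radius of the support, error from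
    rounding the centre, margin to the frontier, and 1 for strictness.\<close>
  define D where "D = B + d + 2 * R0 R + 1"
  define \<epsilon> where "\<epsilon> = r / D"
  \<comment> \<open>Rounding down moves each coordinate of the centre by at most
    \<open>\<epsilon>\<close>, hence the centre by at most \<open>\<epsilon> * d\<close>.\<close>
  define p :: "real ^ 'n" where "p = (\<chi> i. of_int \<lfloor>c $ i / \<epsilon>\<rfloor>)"
  have "0 < D" using B R0_nonneg[of R] by (simp add: D_def d_def add_pos_nonneg)
  then have \<epsilon>: "0 < \<epsilon>" and rD: "r = \<epsilon> * D" using r by (auto simp: \<epsilon>_def)
  have p: "p \<in> int_lattice" by (simp add: p_def int_lattice_def)
  have "norm (c - \<epsilon> *\<^sub>R p) \<le> (\<Sum>i\<in>UNIV. \<bar>(c - \<epsilon> *\<^sub>R p) $ i\<bar>)" by (rule norm_le_l1_cart)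
  also have "\<dots> \<le> (\<Sum>i\<in>(UNIV :: 'n set). \<epsilon>)"
  proof (rule sum_mono)
    fix i
    have "(c - \<epsilon> *\<^sub>R p) $ i = \<epsilon> * frac (c $ i / \<epsilon>)"
      using \<epsilon> by (simp add: p_def frac_def right_diff_distrib)
    moreover have "0 \<le> frac (c $ i / \<epsilon>)" "frac (c $ i / \<epsilon>) \<le> 1"
      by (simp_all add: less_imp_le[OF frac_lt_1])
    ultimately show "\<bar>(c - \<epsilon> *\<^sub>R p) $ i\<bar> \<le> \<epsilon>"
      using \<epsilon> by (simp add: abs_mult)
  qed
  finally have cp: "dist c (\<epsilon> *\<^sub>R p) \<le> \<epsilon> * d" by (simp add: dist_norm d_def mult.commute)
  have far: "\<epsilon> *\<^sub>R z \<in> \<Omega> \<and> 2 * \<epsilon> * R0 R < infdist (\<epsilon> *\<^sub>R z) (frontier \<Omega>)"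
    if "z \<in> int_lattice" "u (z - p) \<noteq> 0" for z
  proof -
    have "norm (z - p) \<le> B" using out[OF int_lattice_diff[OF that(1) p] that(2)] B(2) by blast
    then have "dist (\<epsilon> *\<^sub>R p) (\<epsilon> *\<^sub>R z) \<le> \<epsilon> * B"
      using \<epsilon> by (simp add: dist_norm norm_minus_commute flip: scaleR_diff_right)
    then have dist: "dist c (\<epsilon> *\<^sub>R z) \<le> \<epsilon> * (B + d)"
      using cp dist_triangle[of c "\<epsilon> *\<^sub>R z" "\<epsilon> *\<^sub>R p"] by (simp add: distrib_left)
    have "\<epsilon> * (B + d) + 2 * \<epsilon> * R0 R < r" using \<epsilon> by (simp add: rD D_def algebra_simps)
    then have gap: "2 * \<epsilon> * R0 R < r - dist c (\<epsilon> *\<^sub>R z)" using dist by linarith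
    moreover have "0 \<le> 2 * \<epsilon> * R0 R" using \<epsilon> R0_nonneg[of R] by simp
    ultimately have "\<epsilon> *\<^sub>R z \<in> \<Omega>" using r(2) by (intro subsetD[OF r(2)]) auto
    moreover have "frontier \<Omega> \<noteq> {}"
      using \<Omega> not_bounded_UNIV by (intro frontier_not_empty) auto
    ultimately show ?thesis
      using gap ball_subset_infdist_frontier[OF r(2) \<Omega>(1), of "\<epsilon> *\<^sub>R z"] by auto
  qed
  define y where "y = restrict (\<lambda>x. u ((1 / \<epsilon>) *\<^sub>R x - p)) (\<Omega> \<inter> scaled_lattice \<epsilon>)"
  have y: "y (\<epsilon> *\<^sub>R z) = u (z - p)" if "z \<in> int_lattice" "\<epsilon> *\<^sub>R z \<in> \<Omega>" for z
    using that \<epsilon> by (auto simp: y_def scaled_lattice_def)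
  have "y \<in> admissible R \<epsilon> \<Omega>"
    unfolding admissible_def
  proof (intro CollectI conjI ballI impI)
    fix x assume x: "x \<in> \<Omega> \<inter> scaled_lattice \<epsilon>" "infdist x (frontier \<Omega>) \<le> 2 * \<epsilon> * R0 R"
    then obtain z where z: "z \<in> int_lattice" "x = \<epsilon> *\<^sub>R z" by (auto simp: scaled_lattice_def)
    then show "y x = 0" using far[of z] x y[of z] by fastforce
  qed (auto simp: y_def)
  moreover have "pull_back \<epsilon> \<Omega> y z = u (z - p)" if "z \<in> int_lattice" for z
    using that y[of z] far[of z] by (auto simp: pull_back_def)
  ultimately show thesis using that \<epsilon> p by blast
qed

text \<open>Each admissible function pulls back to a finitely supported one with the same sign of
  the shifted energy. Conversely each finitely supported function that is nonzero on the lattice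
  arises in this way up to translation, from a suitably small spacing.\<close>

lemma le_lambda_atom_iff:
  fixes R \<Omega> :: "(real ^ 'n::finite) set"
  assumes R: "finite R" "R \<subseteq> int_lattice" "0 \<notin> R" "R \<noteq> {}"
    and \<Omega>: "open \<Omega>" "bounded \<Omega>" "\<Omega> \<noteq> {}"
  shows "ereal L \<le> lambda_atom R \<Omega> K \<longleftrightarrow> lattice_stable R (shift_tensor K L)"
proof -
  let ?K = "shift_tensor K L"
  let ?f = "\<lambda>u z. tensor_form R ?K (discrete_grad 1 u z) (discrete_grad 1 u z)"
  note quotient = le_quotient_iff[OF R(1,2) \<Omega>(2) _ R(3,4), where K = K and L = L]
  show ?thesis
  proof
    assume stable: "lattice_stable R ?K"
    show "ereal L \<le> lambda_atom R \<Omega> K"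
      unfolding lambda_atom_def
    proof (intro INF_greatest)
      fix \<epsilon> :: real and y
      assume \<epsilon>: "\<epsilon> \<in> {0<..}"
        and y: "y \<in> {y \<in> admissible R \<epsilon> \<Omega>. \<exists>x\<in>\<Omega> \<inter> scaled_lattice \<epsilon>. y x \<noteq> 0}"
      have "0 \<le> (\<Sum>z\<in>pull_back_sint R \<epsilon> \<Omega>. ?f (pull_back \<epsilon> \<Omega> y) z)"
        using stable support_within_pull_back[OF R(1,2) \<Omega>(2)] \<epsilon> y
        unfolding lattice_stable_def by simp
      then show "ereal L \<le> ereal (
          (\<Sum>x\<in>sint R \<epsilon> \<Omega>. tensor_form R K (discrete_grad \<epsilon> y x) (discrete_grad \<epsilon> y x)) /
          (\<Sum>x\<in>sint R \<epsilon> \<Omega>. mat_norm_sq R (discrete_grad \<epsilon> y x)))"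
        using quotient[of \<epsilon> y] \<epsilon> y by simp
    qed
  next
    assume le: "ereal L \<le> lambda_atom R \<Omega> K"
    show "lattice_stable R ?K"
      unfolding lattice_stable_def
    proof (intro allI impI)
      fix u S assume u: "support_within R u S"
      then have S: "S \<subseteq> int_lattice" by (simp add: support_within_def)
      have shift_lat: "z + \<rho> \<in> int_lattice" if "z \<in> int_lattice" "\<rho> \<in> insert 0 R" for z \<rho>
        using that R(2) by (auto intro: int_lattice_add)
      show "0 \<le> (\<Sum>z\<in>S. ?f u z)"
      proof (cases "\<exists>z\<in>int_lattice. u z \<noteq> 0")
        \<comment> \<open>The zero function is excluded from the infimum, so it needs a separate,
          direct treatment.\<close>
        case False
        then have "(\<Sum>z\<in>S. ?f u z) = 0"
          using S shift_lat by (intro sum.neutral ballI tensor_form_grad_eq_0) blast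
        then show ?thesis by simp
      next
        case True
        then obtain z0 where z0: "z0 \<in> int_lattice" "u z0 \<noteq> 0" by blast
        from rescaled_test_function[OF \<Omega> u] obtain \<epsilon> y p where \<epsilon>: "0 < \<epsilon>"
          and y: "y \<in> admissible R \<epsilon> \<Omega>" and p: "p \<in> int_lattice"
          and pb: "\<And>z. z \<in> int_lattice \<Longrightarrow> pull_back \<epsilon> \<Omega> y z = u (z - p)" by metis
        let ?v = "pull_back \<epsilon> \<Omega> y" and ?S = "pull_back_sint R \<epsilon> \<Omega>"
        have "?v (z0 + p) \<noteq> 0" using pb[OF int_lattice_add[OF z0(1) p]] z0(2) by simp
        then have "\<exists>x \<in> \<Omega> \<inter> scaled_lattice \<epsilon>. y x \<noteq> 0"
          by (auto simp: pull_back_def scaled_lattice_def split: if_splits)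
        moreover from this have "ereal L \<le> ereal (
          (\<Sum>x\<in>sint R \<epsilon> \<Omega>. tensor_form R K (discrete_grad \<epsilon> y x) (discrete_grad \<epsilon> y x)) /
          (\<Sum>x\<in>sint R \<epsilon> \<Omega>. mat_norm_sq R (discrete_grad \<epsilon> y x)))"
          using \<epsilon> y by (intro order_trans[OF le]) (auto simp: lambda_atom_def intro!: INF_lower2)
        ultimately have "0 \<le> (\<Sum>z\<in>?S. ?f ?v z)" using quotient[OF \<epsilon> y] by simp
        \<comment> \<open>The pull-back is a translate of \<open>u\<close>, so the translated window
          \<open>S\<close> serves as well as the one coming from \<open>sint\<close>.\<close>
        also have "\<dots> = (\<Sum>z\<in>(\<lambda>z. z + p) ` S. ?f ?v z)"
        proof (rule support_within_sum_eq)
          show "support_within R ?v ?S" by (rule support_within_pull_back[OF R(1,2) \<Omega>(2) \<epsilon> y])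
          show "support_within R ?v ((\<lambda>z. z + p) ` S)"
            unfolding support_within_def
          proof (intro conjI ballI)
            fix z \<rho> assume z: "z \<in> int_lattice - (\<lambda>z. z + p) ` S" and \<rho>: "\<rho> \<in> insert 0 R"
            then have "z - p \<in> int_lattice - S"
              using int_lattice_diff[OF _ p] by (force simp: image_iff)
            with u \<rho> have "u (z - p + \<rho>) = 0" unfolding support_within_def by blast
            moreover have "z - p + \<rho> = z + \<rho> - p" by simp
            ultimately show "?v (z + \<rho>) = 0" using pb[OF shift_lat[OF _ \<rho>]] z by simp
          qed (use u p in \<open>auto simp: support_within_def intro: int_lattice_add\<close>)
        qed (rule tensor_form_grad_eq_0)
        also have "\<dots> = (\<Sum>z\<in>S. ?f ?v (z + p))" by (subst sum.reindex) auto
        also have "\<dots> = (\<Sum>z\<in>S. ?f u z)"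
        proof (rule sum.cong[OF refl])
          fix z assume "z \<in> S"
          then have z: "z + p \<in> int_lattice" using S p by (auto intro: int_lattice_add)
          have "discrete_grad 1 ?v (z + p) j \<rho> = discrete_grad 1 u z j \<rho>" if "\<rho> \<in> R" for j \<rho>
          proof -
            have "?v (z + p + \<rho>) = u (z + p + \<rho> - p)" using pb[OF shift_lat[OF z]] that by simp
            moreover have "z + p + \<rho> - p = z + \<rho>" by simp
            ultimately show ?thesis using pb[OF z] by (simp add: discrete_grad_def)
          qed
          then show "?f ?v (z + p) = ?f u z" by (intro tensor_form_cong)
        qed
        finally show ?thesis .
      qed
    qed
  qed
qed

text \<open>Between two distinct extended reals lies a real number. Comparing real lower bounds thus
  covers infinite values too.\<close>

lemma ereal_eqI_lower:
  fixes a b :: ereal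
  assumes "\<And>L::real. ereal L \<le> a \<longleftrightarrow> ereal L \<le> b"
  shows "a = b"
proof (rule ccontr)
  assume "a \<noteq> b"
  then consider "a < b" | "b < a" by (meson linorder_neqE)
  then show False using assms ereal_dense2 by cases (meson less_imp_le not_le)+
qed

theorem corollary3p7:
  fixes R :: "(real ^ 'n::finite) set"
    and \<Omega> :: "(real ^ 'n) set"
    and K :: "'n range_tensor"
  assumes "finite R"
    and "R \<subseteq> int_lattice - {0}"
    and "int_span R = int_lattice"
    and "R = uminus ` R"
    and "open \<Omega>" and "bounded \<Omega>" and "\<Omega> \<noteq> {}"
    and "\<And>j l \<rho> \<sigma>. \<rho> \<in> R \<Longrightarrow> \<sigma> \<in> R \<Longrightarrow> K j \<rho> l \<sigma> = K l \<sigma> j \<rho>"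
    and "(\<forall>j l. \<forall>\<rho>\<in>R. \<forall>\<sigma>\<in>R. K j \<rho> l \<sigma> = K j (- \<rho>) l (- \<sigma>)) \<or>
         (\<forall>j l. \<forall>\<rho>\<in>R. \<forall>\<sigma>\<in>R. K j \<rho> l \<sigma> = K l \<rho> j \<sigma>)"
  shows "lambda_atom R \<Omega> K =
    (INF (\<xi>, k) \<in> (UNIV - {0}) \<times> ({k. \<forall>i. 0 \<le> k $ i \<and> k $ i < 2 * pi} - {0}).
       ereal ((tensor_form R K (outer \<xi> (cos_vec k)) (outer \<xi> (cos_vec k)) +
               tensor_form R K (outer \<xi> (sin_vec k)) (outer \<xi> (sin_vec k))) /
              ((norm \<xi>)\<^sup>2 * (vec_norm_sq R (cos_vec k) + vec_norm_sq R (sin_vec k)))))"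
proof (rule ereal_eqI_lower)
  fix L :: real
  let ?K = "shift_tensor K L"
  let ?B = "{k :: real ^ 'n. \<forall>i. 0 \<le> k $ i \<and> k $ i < 2 * pi}"
  have R: "R \<subseteq> int_lattice" "0 \<notin> R" using assms(2) by auto
  have pos: "0 < vec_norm_sq R (cos_vec k) + vec_norm_sq R (sin_vec k)" if "k \<in> ?B - {0}" for k
    using symbol_denominator_pos[OF assms(1,3)] that by auto
  have "R \<noteq> {}"
  proof
    assume "R = {}"
    \<comment> \<open>The vector of ones is a convenient nonzero frequency in the cube, because 1 is
      less than 2 pi; for empty \<open>R\<close> its denominator would be 0.\<close>
    have "(\<chi> i. 1) \<in> ?B - {0}" using pi_ge_two by (auto simp: vec_eq_iff)
    from pos[OF this] show False by (simp add: \<open>R = {}\<close> vec_norm_sq_def)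
  qed
  then have "ereal L \<le> lambda_atom R \<Omega> K \<longleftrightarrow> lattice_stable R ?K"
    using le_lambda_atom_iff[OF assms(1) R _ assms(5-7)] by blast
  also have "\<dots> \<longleftrightarrow> (\<forall>\<xi>. \<forall>k\<in>?B. 0 \<le> symbol_form R ?K \<xi> k)"
  proof
    show "\<forall>\<xi>. \<forall>k\<in>?B. 0 \<le> symbol_form R ?K \<xi> k" if "lattice_stable R ?K"
      using symbol_nonneg_if_lattice_stable[OF assms(1) R(1) that] by blast
    \<comment> \<open>The subtracted multiple of the identity has all the symmetries in question, so
      the shifted tensor inherits those of \<open>K\<close>.\<close>
    have major: "?K j \<rho> l \<sigma> = ?K l \<sigma> j \<rho>" if "\<rho> \<in> R" "\<sigma> \<in> R" for j l \<rho> \<sigma>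
      using assms(8)[OF that, of j l] by (auto simp: shift_tensor_def)
    have minor: "(\<forall>j l. \<forall>\<rho>\<in>R. \<forall>\<sigma>\<in>R. ?K j \<rho> l \<sigma> = ?K j (- \<rho>) l (- \<sigma>)) \<or>
        (\<forall>j l. \<forall>\<rho>\<in>R. \<forall>\<sigma>\<in>R. ?K j \<rho> l \<sigma> = ?K l \<rho> j \<sigma>)"
      using assms(9) by (elim disj_forward) (auto simp: shift_tensor_def)
    show "lattice_stable R ?K" if "\<forall>\<xi>. \<forall>k\<in>?B. 0 \<le> symbol_form R ?K \<xi> k"
      using that
      by (intro lattice_stable_if_symbol_nonneg[OF R(1)]
          tensor_form_outer_cross[OF assms(4) major minor]) auto
  qed
  \<comment> \<open>The symbol is 0 for \<open>\<xi> = 0\<close> or \<open>k = 0\<close>, so these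
    arguments impose no condition; without them the denominator is positive.\<close>
  also have "\<dots> \<longleftrightarrow> (\<forall>\<xi>\<in>UNIV - {0}. \<forall>k\<in>?B - {0}. 0 \<le> symbol_form R ?K \<xi> k)"
    using symbol_form_zero[of R ?K] symbol_form_zero_left[of R ?K]
    by (metis (no_types, lifting) DiffE DiffI UNIV_I empty_iff insert_iff order_refl)
  also have "\<dots> \<longleftrightarrow> (\<forall>\<xi>\<in>UNIV - {0}. \<forall>k\<in>?B - {0}. L \<le> symbol_form R K \<xi> k /
      ((norm \<xi>)\<^sup>2 * (vec_norm_sq R (cos_vec k) + vec_norm_sq R (sin_vec k))))"
  proof (intro ball_cong refl)
    fix \<xi> k :: "real ^ 'n" assume "\<xi> \<in> UNIV - {0}" "k \<in> ?B - {0}"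
    then have "0 < (norm \<xi>)\<^sup>2 * (vec_norm_sq R (cos_vec k) + vec_norm_sq R (sin_vec k))"
      using pos by (intro mult_pos_pos) auto
    then show "0 \<le> symbol_form R ?K \<xi> k \<longleftrightarrow> L \<le> symbol_form R K \<xi> k /
      ((norm \<xi>)\<^sup>2 * (vec_norm_sq R (cos_vec k) + vec_norm_sq R (sin_vec k)))"
      by (simp add: symbol_form_shift[OF assms(1)] le_divide_eq)
  qed
  finally show "ereal L \<le> lambda_atom R \<Omega> K \<longleftrightarrow> ereal L \<le>
    (INF (\<xi>, k) \<in> (UNIV - {0}) \<times> (?B - {0}).
       ereal ((tensor_form R K (outer \<xi> (cos_vec k)) (outer \<xi> (cos_vec k)) +
               tensor_form R K (outer \<xi> (sin_vec k)) (outer \<xi> (sin_vec k))) /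
              ((norm \<xi>)\<^sup>2 * (vec_norm_sq R (cos_vec k) + vec_norm_sq R (sin_vec k)))))"
    by (simp add: le_INF_iff symbol_form_def split_beta del: Diff_iff)
qed

end
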